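(* Let $\sigma:\mathbb{Z}^n\times\mathbb{T}^n\to\mathbb{C}$ be continuously differentiable in $x$ and such that there are $C>0$ and $\rho>0$ with $$|\sigma(k,x)|\le C,\qquad|\nabla_x\sigma(k,x)|\le C\qquad\text{for all }(k,x)\in\mathbb{Z}^n\times\mathbb{T}^n,$$ and such that for every $q\in C^\infty(\mathbb{T}^n)$ with $q(0)=0$ there is $C_q>0$ with $$|\Delta_q\sigma(k,x)|\le C_q(1+|k|)^{-\rho}\qquad\text{for all }(k,x)\in\mathbb{Z}^n\times\mathbb{T}^n.$$ Then for all compact operators $K$ on $\ell^2(\mathbb{Z}^n)$ we have $$\|\mathrm{Op}(\sigma)-K\|_{\mathcal{L}(\ell^2(\mathbb{Z}^n))}\ge\limsup_{|k|\to\infty}\ \sup_{x\in\mathbb{T}^n}|\sigma(k,x)|.$$ In particular, this conclusion holds for any $\sigma\in S^0(\mathbb{Z}^n\times\mathbb{T}^n)$.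
   Context: $\mathbb{T}^n=\mathbb{R}^n/\mathbb{Z}^n$ with normalised Lebesgue measure. $\widehat f(x)=\sum_{k\in\mathbb{Z}^n}e^{-2\pi i k\cdot x}f(k)$ and $\mathrm{Op}(\sigma)f(k)=\int_{\mathbb{T}^n}e^{2\pi i k\cdot x}\sigma(k,x)\widehat f(x)\,dx$. The operator norm is understood to be $+\infty$ if the operator is not bounded on $\ell^2(\mathbb{Z}^n)$. For $q\in C^\infty(\mathbb{T}^n)$ the generalised difference operator $\Delta_q$ acts on functions $\tau$ on $\mathbb{Z}^n$ by $\Delta_q\tau(k)=\int_{\mathbb{T}^n}e^{2\pi i k\cdot y}q(y)\widehat\tau(y)\,dy$, interpreted for bounded (or tempered) $\tau$ by distributional duality; equivalently $\Delta_q\tau(k)=\sum_{l\in\mathbb{Z}^n}\tau(l)\int_{\mathbb{T}^n}e^{2\pi i(k-l)\cdot y}q(y)\,dy$. In $\Delta_q\sigma(k,x)$ it acts in the variable $k$. $\Delta^\alpha=\Delta_1^{\alpha_1}\cdots\Delta_n^{\alpha_n}$ with $\Delta_j\tau(k)=\tau(k+v_j)-\tau(k)$, $v_j$ the $j$-th standard unit vector; $D_x^{(\alpha)}=D_{x_1}^{(\alpha_1)}\cdots D_{x_n}^{(\alpha_n)}$ with $D_{x_j}^{(0)}=I$, $D_{x_j}^{(\ell)}=\prod_{m=0}^{\ell-1}\big(\frac{1}{2\pi i}\frac{\partial}{\partial x_j}-m\big)$ for $\ell\ge1$. The class $S^0(\mathbb{Z}^n\times\mathbb{T}^n)$ consists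 of $\sigma:\mathbb{Z}^n\times\mathbb{T}^n\to\mathbb{C}$ with $\sigma(k,\cdot)\in C^\infty(\mathbb{T}^n)$ for all $k$ and, for all multi-indices $\alpha,\beta$, $|D_x^{(\beta)}\Delta_k^\alpha\sigma(k,x)|\le C_{\alpha,\beta}(1+|k|)^{-|\alpha|}$ for all $(k,x)$. *)

theory Defs
  imports "HOL-Analysis.Analysis"
begin

definition zvec :: "int ^ 'n \<Rightarrow> real ^ 'n" where
  "zvec k = (\<chi> j. real_of_int (k $ j))"

definition znorm :: "int ^ 'n::finite \<Rightarrow> real" where
  "znorm k = norm (zvec k)"

definition character :: "int ^ 'n::finite \<Rightarrow> real ^ 'n \<Rightarrow> complex" where
  "character k x = exp (2 * pi * \<i> * of_real (zvec k \<bullet> x))"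

text \<open>Functions on the torus are represented by \<open>\<int>\<^sup>n\<close>-periodic functions on \<open>\<real>\<^sup>n\<close>, and
  integration over the torus is integration over the unit cube.\<close>

definition periodic :: "(real ^ 'n::finite \<Rightarrow> complex) \<Rightarrow> bool" where
  "periodic f \<longleftrightarrow> (\<forall>x m. f (x + zvec m) = f x)"

definition torus :: "(real ^ 'n::finite) measure" where
  "torus = restrict_space lborel (cbox 0 1)"

definition partial :: "'n::finite \<Rightarrow> (real ^ 'n \<Rightarrow> complex) \<Rightarrow> real ^ 'n \<Rightarrow> complex" where
  "partial j f x = frechet_derivative f (at x) (axis j 1)"

definition grad :: "(real ^ 'n::finite \<Rightarrow> complex) \<Rightarrow> real ^ 'n \<Rightarrow> complex ^ 'n" where
  "grad f x = (\<chi> j. partial j f x)"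

primrec times_cont_diff :: "nat \<Rightarrow> (real ^ 'n::finite \<Rightarrow> complex) \<Rightarrow> bool" where
  "times_cont_diff 0 f \<longleftrightarrow> continuous_on UNIV f"
| "times_cont_diff (Suc m) f \<longleftrightarrow>
     f differentiable_on UNIV \<and> (\<forall>j. times_cont_diff m (partial j f))"

definition C1_torus :: "(real ^ 'n::finite \<Rightarrow> complex) set" where
  "C1_torus = {f. periodic f \<and> times_cont_diff 1 f}"

definition smooth_torus :: "(real ^ 'n::finite \<Rightarrow> complex) set" where
  "smooth_torus = {f. periodic f \<and> (\<forall>m. times_cont_diff m f)}"

definition ell2 :: "(int ^ 'n::finite \<Rightarrow> complex) set" where
  "ell2 = {f. (\<lambda>k. (cmod (f k))\<^sup>2) summable_on UNIV}"

definition ell2_norm :: "(int ^ 'n::finite \<Rightarrow> complex) \<Rightarrow> real" where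
  "ell2_norm f = sqrt (\<Sum>\<^sub>\<infinity>k. (cmod (f k))\<^sup>2)"

definition ell2_dist :: "(int ^ 'n::finite \<Rightarrow> complex) \<Rightarrow> (int ^ 'n \<Rightarrow> complex) \<Rightarrow> real" where
  "ell2_dist f g = ell2_norm (\<lambda>k. f k - g k)"

lemma ell2_partial_sum_le:
  assumes "f \<in> ell2" "finite F"
  shows "L2_set (\<lambda>k. cmod (f k)) F \<le> ell2_norm f"
  using assms unfolding ell2_def ell2_norm_def L2_set_def
  by (auto intro!: real_sqrt_le_mono finite_sum_le_infsum)

lemma ell2_add_bound:
  assumes "f \<in> ell2" "g \<in> ell2"
  shows "(\<lambda>k. f k + g k) \<in> ell2 \<and> ell2_norm (\<lambda>k. f k + g k) \<le> ell2_norm f + ell2_norm g"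
proof -
  let ?B = "ell2_norm f + ell2_norm g"
  have le: "(\<Sum>k\<in>F. (cmod (f k + g k))\<^sup>2) \<le> ?B\<^sup>2" if "finite F" for F
  proof -
    have "L2_set (\<lambda>k. cmod (f k + g k)) F \<le> L2_set (\<lambda>k. cmod (f k) + cmod (g k)) F"
      by (intro L2_set_mono) (auto simp: norm_triangle_ineq)
    also have "\<dots> \<le> L2_set (\<lambda>k. cmod (f k)) F + L2_set (\<lambda>k. cmod (g k)) F"
      by (rule L2_set_triangle_ineq)
    also have "\<dots> \<le> ?B"
      using ell2_partial_sum_le[OF assms(1) that] ell2_partial_sum_le[OF assms(2) that] by simp
    finally have "sqrt (\<Sum>k\<in>F. (cmod (f k + g k))\<^sup>2) \<le> ?B" by (simp add: L2_set_def)
    then show ?thesis by (rule sqrt_le_D)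
  qed
  have sm: "(\<lambda>k. (cmod (f k + g k))\<^sup>2) summable_on UNIV"
    by (rule nonneg_bounded_partial_sums_imp_summable_on[where C = "?B\<^sup>2"])
      (auto intro!: eventually_finite_subsets_at_top_weakI le)
  have "(\<Sum>\<^sub>\<infinity>k. (cmod (f k + g k))\<^sup>2) \<le> ?B\<^sup>2"
    using sm le by (intro infsum_le_finite_sums) auto
  moreover have "0 \<le> ?B" by (simp add: ell2_norm_def infsum_nonneg)
  ultimately have "ell2_norm (\<lambda>k. f k + g k) \<le> ?B"
    unfolding ell2_norm_def[of "\<lambda>k. f k + g k"] by (simp add: real_le_lsqrt infsum_nonneg)
  with sm show ?thesis by (simp add: ell2_def)
qed

lemma ell2_diff:
  assumes "f \<in> ell2" "g \<in> ell2"
  shows "(\<lambda>k. f k - g k) \<in> ell2"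
proof -
  have "(\<lambda>k. - g k) \<in> ell2" using assms by (simp add: ell2_def)
  from ell2_add_bound[OF assms(1) this] show ?thesis by simp
qed

interpretation ell2: Metric_space ell2 ell2_dist
proof
  fix f g h :: "int ^ 'n \<Rightarrow> complex"
  show "0 \<le> ell2_dist f g" by (simp add: ell2_dist_def ell2_norm_def infsum_nonneg)
  show "ell2_dist f g = ell2_dist g f"
    by (simp add: ell2_dist_def ell2_norm_def norm_minus_commute)
  assume f: "f \<in> ell2" and g: "g \<in> ell2"
  show "(ell2_dist f g = 0) = (f = g)"
  proof
    assume "ell2_dist f g = 0"
    then have "L2_set (\<lambda>k. cmod (f k - g k)) {k} \<le> 0" for k
      using ell2_partial_sum_le[OF ell2_diff[OF f g], of "{k}"] by (simp add: ell2_dist_def)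
    then show "f = g" by (auto simp: fun_eq_iff)
  qed (simp add: ell2_dist_def ell2_norm_def)
  assume h: "h \<in> ell2"
  show "ell2_dist f h \<le> ell2_dist f g + ell2_dist g h"
    using ell2_add_bound[OF ell2_diff[OF f g] ell2_diff[OF g h]] by (simp add: ell2_dist_def)
qed

definition compact_operator ::
    "((int ^ 'n::finite \<Rightarrow> complex) \<Rightarrow> (int ^ 'n \<Rightarrow> complex)) \<Rightarrow> bool" where
  "compact_operator K \<longleftrightarrow>
     (\<forall>f\<in>ell2. K f \<in> ell2) \<and>
     (\<forall>f\<in>ell2. \<forall>g\<in>ell2. K (\<lambda>k. f k + g k) = (\<lambda>k. K f k + K g k)) \<and>
     (\<forall>c. \<forall>f\<in>ell2. K (\<lambda>k. c * f k) = (\<lambda>k. c * K f k)) \<and>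
     compactin ell2.mtopology
       (ell2.mtopology closure_of (K ` {f \<in> ell2. ell2_norm f \<le> 1}))"

text \<open>The operator norm is \<open>\<infinity>\<close> if the operator fails to map the sequence space into itself, or
  does so without being bounded.\<close>

definition ell2_operator_norm ::
    "((int ^ 'n::finite \<Rightarrow> complex) \<Rightarrow> (int ^ 'n \<Rightarrow> complex)) \<Rightarrow> ereal" where
  "ell2_operator_norm A =
     (SUP f\<in>{f \<in> ell2. ell2_norm f \<le> 1}. if A f \<in> ell2 then ereal (ell2_norm (A f)) else \<infinity>)"

text \<open>For a square-summable sequence the Fourier series converges (unconditionally) in
  \<open>L\<^sup>2\<close> of the torus, so the transform is determined up to a null set; the choice of
  representative does not affect integrals against it.\<close>

definition has_fourier_transform ::
    "(int ^ 'n::finite \<Rightarrow> complex) \<Rightarrow> (real ^ 'n \<Rightarrow> complex) \<Rightarrow> bool" where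
  "has_fourier_transform f g \<longleftrightarrow>
     g \<in> borel_measurable torus \<and>
     integrable torus (\<lambda>x. (cmod (g x))\<^sup>2) \<and>
     ((\<lambda>F. LINT x|torus. (cmod (g x - (\<Sum>k\<in>F. character (- k) x * f k)))\<^sup>2) \<longlongrightarrow> 0)
       (finite_subsets_at_top UNIV)"

definition fourier_transform ::
    "(int ^ 'n::finite \<Rightarrow> complex) \<Rightarrow> real ^ 'n \<Rightarrow> complex" where
  "fourier_transform f = (SOME g. has_fourier_transform f g)"

definition Op ::
    "(int ^ 'n::finite \<Rightarrow> real ^ 'n \<Rightarrow> complex) \<Rightarrow> (int ^ 'n \<Rightarrow> complex) \<Rightarrow> int ^ 'n \<Rightarrow> complex" where
  "Op \<sigma> f k = (LINT x|torus. character k x * \<sigma> k x * fourier_transform f x)"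

text \<open>The distributional pairing of the Fourier transform of \<open>\<tau>\<close> with
  \<open>y \<mapsto> e\<^sup>2\<^sup>\<pi>\<^sup>i\<^sup>k\<^sup>\<cdot>\<^sup>y q(y)\<close>, written out as a series; it converges absolutely for bounded \<open>\<tau>\<close>
  and smooth \<open>q\<close>.\<close>

definition gen_difference ::
    "(real ^ 'n::finite \<Rightarrow> complex) \<Rightarrow> (int ^ 'n \<Rightarrow> complex) \<Rightarrow> int ^ 'n \<Rightarrow> complex" where
  "gen_difference q \<tau> k = (\<Sum>\<^sub>\<infinity>l. \<tau> l * (LINT y|torus. character (k - l) y * q y))"

definition difference :: "'n::finite \<Rightarrow> (int ^ 'n \<Rightarrow> complex) \<Rightarrow> int ^ 'n \<Rightarrow> complex" where
  "difference j \<tau> k = \<tau> (k + axis j 1) - \<tau> k"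

primrec D_coord ::
    "'n::finite \<Rightarrow> nat \<Rightarrow> (real ^ 'n \<Rightarrow> complex) \<Rightarrow> real ^ 'n \<Rightarrow> complex" where
  "D_coord j 0 f = f"
| "D_coord j (Suc m) f =
     (\<lambda>x. 1 / (2 * pi * \<i>) * partial j (D_coord j m f) x - of_nat m * D_coord j m f x)"

text \<open>An arbitrary enumeration of the coordinates, needed because composition is not commutative
  in general. The operators composed below commute (the \<open>D_coord\<close> on smooth functions), so the
  choice is immaterial.\<close>

definition coords :: "'n::finite list" where
  "coords = (SOME js. distinct js \<and> set js = UNIV)"

definition multi_difference ::
    "('n::finite \<Rightarrow> nat) \<Rightarrow> (int ^ 'n \<Rightarrow> complex) \<Rightarrow> int ^ 'n \<Rightarrow> complex" where
  "multi_difference \<alpha> = foldr (\<lambda>j. difference j ^^ \<alpha> j) coords"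

definition multi_D ::
    "('n::finite \<Rightarrow> nat) \<Rightarrow> (real ^ 'n \<Rightarrow> complex) \<Rightarrow> real ^ 'n \<Rightarrow> complex" where
  "multi_D \<beta> = foldr (\<lambda>j. D_coord j (\<beta> j)) coords"

definition S0 :: "(int ^ 'n::finite \<Rightarrow> real ^ 'n \<Rightarrow> complex) set" where
  "S0 = {\<sigma>. (\<forall>k. \<sigma> k \<in> smooth_torus) \<and>
     (\<forall>\<alpha> \<beta>. \<exists>C. \<forall>k x.
        cmod (multi_D \<beta> (\<lambda>y. multi_difference \<alpha> (\<lambda>l. \<sigma> l y) k) x)
          \<le> C * (1 + znorm k) powr - real (\<Sum>j\<in>UNIV. \<alpha> j))}"

end

theory Submission
  imports Defs
begin

text \<open>
  The operator norm is bounded below by the pairings of \<open>(Op(\<sigma>) - K) f\<close> with unit vectors \<open>f\<close>. Take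
  \<open>f\<close> to be a wave packet \<open>m \<mapsto> exp(2\<pi>i(m - k\<^sub>0)\<cdot>x\<^sub>0)\<close> on a translate \<open>k\<^sub>0 + Q\<close> of a fixed finite set
  \<open>Q \<subseteq> \<int>\<^sup>n\<close>, normalised. Because \<open>Q\<close> stays fixed as \<open>k\<^sub>0 \<rightarrow> \<infinity>\<close>, the decay of \<open>\<Delta>\<^sub>q\<sigma>\<close> for the
  finitely many functions \<open>q(y) = exp(2\<pi>i y\<^sub>j) - 1\<close> lets one replace \<open>\<sigma>(k\<^sub>0 + m, x)\<close> by \<open>\<sigma>(k\<^sub>0, x)\<close> in
  the pairing. By Parseval, the squared Fourier transform of \<open>f\<close> concentrates at \<open>x\<^sub>0\<close> once \<open>Q\<close> is
  almost invariant under the coordinate translations, and the gradient bound then lets one replace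
  \<open>\<sigma>(k\<^sub>0, x)\<close> by \<open>\<sigma>(k\<^sub>0, x\<^sub>0)\<close>, uniformly in \<open>x\<^sub>0\<close>. Hence the pairing of \<open>Op(\<sigma>) f\<close> with \<open>f\<close> is
  close to \<open>\<sigma>(k\<^sub>0, x\<^sub>0)\<close>, while that of \<open>K f\<close> with \<open>f\<close> tends to \<open>0\<close>, since \<open>K\<close> maps the unit ball to
  a totally bounded set.
\<close>

section \<open>Characters and integration over the torus\<close>

lemma zvec_add: "zvec (k + l) = zvec k + zvec l"
  and zvec_uminus: "zvec (- k) = - zvec k"
  and zvec_0: "zvec 0 = 0"
  by (simp_all add: zvec_def vec_eq_iff)

lemma zvec_axis: "zvec (axis j 1) = (axis j 1 :: real ^ 'n::finite)"
  by (simp add: zvec_def axis_def vec_eq_iff)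

lemma zvec_inner_zvec: "zvec k \<bullet> zvec l = real_of_int (\<Sum>j\<in>UNIV. k $ j * l $ j)"
  by (simp add: zvec_def inner_vec_def)

lemma character_eq_cis: "character k x = cis (2 * pi * (zvec k \<bullet> x))"
  by (simp add: character_def cis_conv_exp mult_ac)

lemma character_add: "character (k + l) x = character k x * character l x"
  and character_uminus: "character (- k) x = cnj (character k x)"
  and character_add_right: "character k (x + y) = character k x * character k y"
  and character_uminus_right: "character k (- x) = cnj (character k x)"
  by (simp_all add: character_eq_cis zvec_add zvec_uminus inner_add_left inner_add_right
      distrib_left cis_mult cis_cnj)

lemma character_diff: "character (k - l) x = character k x * cnj (character l x)"
  using character_add[of k "- l" x] by (simp add: character_uminus)

lemma character_diff_right: "character k (x - y) = character k x * cnj (character k y)"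
  using character_add_right[of k x "- y"] by (simp add: character_uminus_right)

lemma character_0: "character 0 x = 1"
  by (simp add: character_eq_cis zvec_0)

lemma norm_character: "cmod (character k x) = 1"
  by (simp add: character_eq_cis)

lemma character_cnj_mult: "cnj (character k x) * character k x = 1"
  by (simp add: character_eq_cis cis_cnj cis_mult)

lemma character_periodic: "character k (x + zvec m) = character k x"
proof -
  have "character k (zvec m) = 1"
    unfolding character_eq_cis zvec_inner_zvec by (rule cis_multiple_2pi) (rule Ints_of_int)
  then show ?thesis by (simp add: character_add_right)
qed

lemma continuous_on_character: "continuous_on S (character k)"
  unfolding character_def by (intro continuous_intros)

lemma has_derivative_character:
  "(character k has_derivative (\<lambda>h. 2 * pi * \<i> * of_real (zvec k \<bullet> h) * character k x)) (at x)"
proof -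
  have "((\<lambda>x. complex_of_real (zvec k \<bullet> x)) has_derivative (\<lambda>h. of_real (zvec k \<bullet> h))) (at x)"
    by (intro has_derivative_of_real has_derivative_inner_right has_derivative_ident)
  then have "((\<lambda>x. exp (2 * pi * \<i> * of_real (zvec k \<bullet> x))) has_derivative
      (\<lambda>h. exp (2 * pi * \<i> * of_real (zvec k \<bullet> x)) * (2 * pi * \<i> * of_real (zvec k \<bullet> h)))) (at x)"
    by (intro has_derivative_compose[OF _ DERIV_exp[unfolded has_field_derivative_def]]
        has_derivative_mult_right)
  then show ?thesis
    unfolding character_def[abs_def] by (simp add: mult_ac)
qed

lemma partial_eqI: "(f has_derivative f') (at x) \<Longrightarrow> partial j f x = f' (axis j 1)"
  unfolding partial_def by (metis frechet_derivative_at)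

text \<open>Differentiating \<open>a * character k x + b\<close> gives a multiple of the same
  character, so the family is closed under partial derivatives and the induction runs with
  \<open>a\<close>, \<open>b\<close> arbitrary. The constant \<open>b\<close> admits functions such
  as \<open>character m - 1\<close>, which vanish at 0.\<close>

lemma times_cont_diff_affine_character:
  "times_cont_diff m (\<lambda>x. a * character k x + b)"
proof (induction m arbitrary: a b)
  case 0
  show ?case by (auto intro!: continuous_intros continuous_on_character)
next
  case (Suc m)
  have D: "((\<lambda>x. a * character k x + b) has_derivative
      (\<lambda>h. a * (2 * pi * \<i> * of_real (zvec k \<bullet> h) * character k x))) (at x)" for x
    by (auto intro!: derivative_eq_intros has_derivative_character)
  have "partial j (\<lambda>x. a * character k x + b) =
      (\<lambda>x. (a * (2 * pi * \<i> * of_real (zvec k \<bullet> axis j 1))) * character k x + 0)" for j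
    by (rule ext) (simp add: partial_eqI[OF D])
  moreover have "(\<lambda>x. a * character k x + b) differentiable_on UNIV"
    using D by (auto simp: differentiable_on_def differentiable_def)
  ultimately show ?case
    using Suc[of _ 0] by simp
qed

lemma smooth_torus_affine_character: "(\<lambda>x. a * character k x + b) \<in> smooth_torus"
  by (auto simp: smooth_torus_def periodic_def character_periodic times_cont_diff_affine_character)

section \<open>Integration over the unit cube and orthogonality of characters\<close>

lemma space_torus: "space torus = cbox 0 1"
  by (simp add: torus_def space_restrict_space)

lemma finite_measure_torus: "finite_measure (torus :: (real ^ 'n::finite) measure)"
proof (rule finite_measureI)
  have "emeasure (lborel :: (real ^ 'n) measure) (cbox 0 1) = 1"
    by (subst emeasure_lborel_cbox) (auto simp: Basis_vec_def inner_axis intro!: prod.neutral)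
  then show "emeasure (torus :: (real ^ 'n) measure) (space torus) \<noteq> \<infinity>"
    by (simp add: space_torus torus_def emeasure_restrict_space)
qed

lemma borel_measurable_torus:
  assumes "continuous_on UNIV f"
  shows "f \<in> borel_measurable torus"
proof -
  have "f \<in> borel_measurable lborel"
    using borel_measurable_continuous_onI[OF assms] by simp
  then show ?thesis unfolding torus_def by (rule measurable_restrict_space1)
qed

lemma integrable_torus:
  fixes f :: "real ^ 'n::finite \<Rightarrow> 'b::{banach,second_countable_topology}"
  assumes "continuous_on UNIV f"
  shows "integrable torus f"
proof -
  have "compact (f ` cbox 0 1)"
    using assms continuous_on_subset by (intro compact_continuous_image) auto
  then obtain B where "\<forall>x\<in>cbox 0 1. norm (f x) \<le> B"
    by (auto dest!: compact_imp_bounded simp: bounded_iff)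
  then show ?thesis
    by (intro finite_measure.integrable_const_bound[of _ _ B] finite_measure_torus
        borel_measurable_torus assms)
      (auto simp: space_torus)
qed

text \<open>Fubini for products of one-variable functions: \<open>lborel_eq\<close> presents
  Lebesgue measure as the image of the product measure under the coordinate expansion, and
  \<open>f b\<close> sees only the coordinate \<open>b\<close>.\<close>

lemma lborel_integral_prod:
  fixes f :: "'a::euclidean_space \<Rightarrow> real \<Rightarrow> 'b::{real_normed_field,banach,second_countable_topology}"
  assumes int: "\<And>b. b \<in> Basis \<Longrightarrow> integrable lborel (f b)"
  shows "(LINT x|lborel. (\<Prod>b\<in>Basis. f b (x \<bullet> b))) = (\<Prod>b\<in>Basis. LINT t|lborel. f b t)"
proof -
  interpret product_sigma_finite "\<lambda>_::'a. lborel :: real measure"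
    by (simp add: product_sigma_finite_def sigma_finite_lborel)
  have [measurable]: "f b \<in> borel_measurable borel" if "b \<in> Basis" for b
    using borel_measurable_integrable[OF int[OF that]] by simp
  have "(LINT x|lborel. (\<Prod>b\<in>Basis. f b (x \<bullet> b))) =
      (LINT g|(\<Pi>\<^sub>M b\<in>Basis. lborel). (\<Prod>b\<in>Basis. f b ((\<Sum>c\<in>Basis. g c *\<^sub>R c) \<bullet> b)))"
    by (subst lborel_eq) (subst integral_distr, measurable)
  also have "\<dots> = (LINT g|(\<Pi>\<^sub>M b\<in>Basis. lborel). (\<Prod>b\<in>Basis. f b (g b)))"
    by (intro Bochner_Integration.integral_cong refl prod.cong) simp
  also have "\<dots> = (\<Prod>b\<in>Basis. LINT t|lborel. f b t)"
    by (rule product_integral_prod) (use int in auto)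
  finally show ?thesis .
qed

lemma integral_unit_interval_exp:
  "(LINT t|lborel. indicator {0..1} t *\<^sub>R exp (2 * pi * \<i> * of_int m * of_real t)) =
    (if m = 0 then 1 else 0 :: complex)"
proof (cases "m = 0")
  case True
  then show ?thesis by (simp add: measure_def)
next
  case False
  define c where "c = 2 * pi * \<i> * complex_of_int m"
  have c: "c \<noteq> 0" using False by (simp add: c_def)
  have "(LINT t|lborel. indicator {0..1} t *\<^sub>R exp (c * of_real t)) =
      exp (c * of_real 1) / c - exp (c * of_real 0) / c"
    using c by (intro integral_FTC_Icc) (auto intro!: derivative_eq_intros continuous_intros
        has_vector_derivative_real_field)
  also have "exp (c * of_real 1) = 1"
    by (simp add: c_def exp_eq_1)
  finally show ?thesis using False by (simp add: c_def)
qed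

text \<open>A character is a product of one-variable exponentials with integer frequencies, and each
  factor integrates over the unit interval to 1 or 0 according to whether its frequency
  vanishes.\<close>

lemma integral_torus_character:
  "(LINT x|torus. character k x) = (if k = 0 then 1 else 0)" for k :: "int ^ 'n::finite"
proof -
  \<comment> \<open>The indicator of the interval is part of each factor, so that the integral over
    the cube becomes an integral of a product over the whole space.\<close>
  define f :: "real ^ 'n \<Rightarrow> real \<Rightarrow> complex" where
    "f b t = indicator {0..1} t *\<^sub>R exp (2 * pi * \<i> * of_real (zvec k \<bullet> b) * of_real t)" for b t
  have f_axis: "f (axis j 1) = (\<lambda>t. indicator {0..1} t *\<^sub>R exp (2 * pi * \<i> * of_int (k $ j) * of_real t))" for j
    by (simp add: f_def[abs_def] inner_axis zvec_def)
  have Basis: "Basis = (\<lambda>j. axis j 1 :: real ^ 'n) ` UNIV"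
    by (auto simp: Basis_vec_def)
  have inj: "inj (\<lambda>j. axis j 1 :: real ^ 'n)"
    by (simp add: inj_def axis_eq_axis)
  have "indicator (cbox 0 1) x *\<^sub>R character k x = (\<Prod>b\<in>Basis. f b (x \<bullet> b))" for x
  proof -
    have "(\<Prod>b\<in>Basis. f b (x \<bullet> b)) =
        (\<Prod>j\<in>UNIV. of_real (indicator {0..1} (x $ j)) * exp (2 * pi * \<i> * of_int (k $ j) * of_real (x $ j)))"
      unfolding Basis by (simp add: prod.reindex[OF inj] f_axis inner_axis scaleR_conv_of_real)
    also have "\<dots> = of_real (\<Prod>j\<in>UNIV. indicator {0..1} (x $ j)) * character k x"
      by (simp add: prod.distrib character_def zvec_def inner_vec_def exp_sum[symmetric]
          sum_distrib_left mult_ac)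
    also have "(\<Prod>j\<in>UNIV. indicator {0..1} (x $ j)) = (indicator (cbox 0 1) x :: real)"
      by (auto simp: indicator_def mem_box_cart)
    finally show ?thesis by (simp add: scaleR_conv_of_real)
  qed
  then have "(LINT x|torus. character k x) = (LINT x|lborel. (\<Prod>b\<in>Basis. f b (x \<bullet> b)))"
    by (simp add: torus_def integral_restrict_space)
  also have "\<dots> = (\<Prod>b\<in>Basis. LINT t|lborel. f b t)"
    by (rule lborel_integral_prod)
      (auto simp: f_def intro!: borel_integrable_compact continuous_on_exp continuous_on_mult continuous_on_const
        continuous_on_of_real_id)
  also have "\<dots> = (\<Prod>j\<in>UNIV. if k $ j = 0 then 1 else 0)"
    unfolding Basis prod.reindex[OF inj] comp_def f_axis integral_unit_interval_exp ..
  also have "\<dots> = (if k = 0 then 1 else 0)"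
    by (auto simp: vec_eq_iff)
  finally show ?thesis .
qed

section \<open>Concentration and pairings in the sequence space\<close>

text \<open>Parseval for trigonometric polynomials: the square expands into a double sum of which
  orthogonality keeps the diagonal.\<close>

lemma integral_torus_norm_square:
  assumes "finite S"
  shows "(LINT x|torus. (cmod (\<Sum>k\<in>S. a k * character k x))\<^sup>2) = (\<Sum>k\<in>S. (cmod (a k))\<^sup>2)"
proof -
  have int: "integrable torus (\<lambda>x. a k * cnj (a l) * character (k - l) x)" for k l
    by (intro integrable_torus continuous_intros continuous_on_character)
  have "complex_of_real (LINT x|torus. (cmod (\<Sum>k\<in>S. a k * character k x))\<^sup>2) =
      (LINT x|torus. complex_of_real ((cmod (\<Sum>k\<in>S. a k * character k x))\<^sup>2))"
    by (rule integral_complex_of_real[symmetric])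
  also have "\<dots> = (LINT x|torus. (\<Sum>k\<in>S. \<Sum>l\<in>S. a k * cnj (a l) * character (k - l) x))"
    by (simp add: complex_norm_square sum_product character_diff mult_ac
        del: of_real_power)
  also have "\<dots> = (\<Sum>k\<in>S. \<Sum>l\<in>S. a k * cnj (a l) * (if k = l then 1 else 0))"
    using int by (simp add: integral_torus_character)
  also have "\<dots> = (\<Sum>k\<in>S. a k * cnj (a k))"
    using assms by (simp add: if_distrib[of "\<lambda>z. _ * z"] sum.delta cong: if_cong)
  also have "\<dots> = complex_of_real (\<Sum>k\<in>S. (cmod (a k))\<^sup>2)"
    by (simp add: complex_norm_square del: of_real_power)
  finally show ?thesis by (simp only: of_real_eq_iff)
qed

lemma integral_torus_sum_character_square:
  assumes "finite S"
  shows "(LINT x|torus. (cmod (\<Sum>k\<in>S. character k (x\<^sub>0 - x)))\<^sup>2) = card S"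
proof -
  have "(\<Sum>k\<in>S. character k (x\<^sub>0 - x)) = cnj (\<Sum>k\<in>S. cnj (character k x\<^sub>0) * character k x)" for x
    by (simp add: character_diff_right)
  then show ?thesis
    using integral_torus_norm_square[OF assms, of "\<lambda>k. cnj (character k x\<^sub>0)"]
    by (simp add: norm_character del: cnj_sum)
qed

text \<open>A discrete cube of side \<open>N\<close> works: the points lost under a unit shift in
  direction \<open>j\<close> lie on the face where the \<open>j\<close>-th coordinate is 0, which
  makes up the fraction 1/N of the cube.\<close>

lemma exists_almost_invariant_set:
  fixes N :: nat
  assumes "N > 0"
  obtains Q :: "(int ^ 'n::finite) set" where "finite Q" "Q \<noteq> {}"
    "\<And>j. N * card (Q - (\<lambda>k. k + axis j 1) ` Q) \<le> card Q"
proof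
  define Q where "Q = {k :: int ^ 'n. \<forall>j. 0 \<le> k $ j \<and> k $ j < int N}"
  have "Q \<subseteq> vec_lambda ` (PiE UNIV (\<lambda>_. {0..<int N}))"
  proof
    fix k assume "k \<in> Q"
    then have "vec_nth k \<in> PiE UNIV (\<lambda>_. {0..<int N})" by (auto simp: Q_def)
    then show "k \<in> vec_lambda ` (PiE UNIV (\<lambda>_. {0..<int N}))"
      by (metis imageI vec_nth_inverse)
  qed
  then show fin: "finite Q" by (rule finite_subset) (intro finite_imageI finite_PiE; simp)
  have "0 \<in> Q" using assms by (simp add: Q_def)
  then show "Q \<noteq> {}" by blast
  fix j
  let ?A = "Q - (\<lambda>k. k + axis j 1) ` Q"
  have A: "k \<in> Q" "k $ j = 0" if "k \<in> ?A" for k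
  proof -
    show "k \<in> Q" using that by simp
    show "k $ j = 0"
    proof (rule ccontr)
      assume "k $ j \<noteq> 0"
      then have "k - axis j 1 \<in> Q" using \<open>k \<in> Q\<close>
        unfolding Q_def by (auto simp: axis_def) (smt (verit))+
      then have "k \<in> (\<lambda>k. k + axis j 1) ` Q" by (metis diff_add_cancel imageI)
      then show False using that by simp
    qed
  qed
  \<comment> \<open>Each point of the face starts a segment of \<open>N\<close> points of
    \<open>Q\<close> in direction \<open>j\<close>. These segments are disjoint: the
    \<open>j\<close>-th coordinate of a point recovers \<open>t\<close>, and then
    \<open>k\<close>.\<close>
  have "card (?A \<times> {..<N}) \<le> card Q"
  proof (rule card_inj_on_le[OF _ _ fin])
    show "inj_on (\<lambda>(k, t). k + axis j (int t)) (?A \<times> {..<N})"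
    proof (rule inj_onI, clarify)
      fix k s l t
      assume k: "k \<in> Q" "k \<notin> (\<lambda>k. k + axis j 1) ` Q"
        and l: "l \<in> Q" "l \<notin> (\<lambda>k. k + axis j 1) ` Q"
        and eq: "k + axis j (int s) = l + axis j (int t)"
      have "(k + axis j (int s)) $ j = (l + axis j (int t)) $ j" using eq by simp
      moreover have "k $ j = 0" "l $ j = 0" using A(2) k l by blast+
      ultimately have "s = t" by (simp add: axis_def)
      then show "k = l \<and> s = t" using eq by simp
    qed
    have "k + axis j (int t) \<in> Q" if "k \<in> ?A" "t < N" for k t
      using A[OF that(1)] that(2) by (auto simp: Q_def axis_def)
    then show "(\<lambda>(k, t). k + axis j (int t)) ` (?A \<times> {..<N}) \<subseteq> Q" by auto
  qed
  then show "N * card ?A \<le> card Q" by (simp add: card_cartesian_product mult.commute)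
qed

text \<open>Multiplication by the character of the unit vector shifts \<open>Q\<close>, so in the
  product with \<open>1 - character\<close> the common part of \<open>Q\<close> and its shift
  cancels. Only the two boundary layers remain, and Parseval counts them. The weight vanishes
  exactly where the \<open>j\<close>-th coordinates of \<open>x\<close> and \<open>x\<^sub>0\<close>
  agree modulo 1, so a small integral expresses concentration there.\<close>

lemma integral_torus_concentration:
  fixes Q :: "(int ^ 'n::finite) set"
  assumes "finite Q"
  shows "(LINT x|torus. (cmod (\<Sum>k\<in>Q. character k (x\<^sub>0 - x)))\<^sup>2 *
      (cmod (1 - character (axis j 1) (x\<^sub>0 - x)))\<^sup>2) \<le> 4 * card (Q - (\<lambda>k. k + axis j 1) ` Q)"
    (is "(LINT x|torus. ?f x) \<le> _")
proof -
  let ?Q' = "(\<lambda>k. k + axis j 1) ` Q"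
  let ?P = "\<lambda>S x. \<Sum>k\<in>S. character k (x\<^sub>0 - x)"
  have card_Q': "card ?Q' = card Q" by (intro card_image) (simp add: inj_on_def)
  have card: "card (?Q' - Q) = card (Q - ?Q')"
    using assms card_Q' by (simp add: card_Diff_subset_Int Int_commute)
  have cont: "continuous_on UNIV (\<lambda>x. character k (x\<^sub>0 - x))" for k
    by (intro continuous_on_compose2[OF continuous_on_character[of UNIV]] continuous_intros) auto
  have le: "?f x \<le> 2 * (cmod (?P (Q - ?Q') x))\<^sup>2 + 2 * (cmod (?P (?Q' - Q) x))\<^sup>2" for x
  proof -
    have "?P ?Q' x = ?P Q x * character (axis j 1) (x\<^sub>0 - x)"
      by (subst sum.reindex) (auto simp: inj_on_def character_add sum_distrib_right)
    moreover have "?P Q x = ?P (Q - ?Q') x + ?P (Q \<inter> ?Q') x"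
      by (subst sum.Int_Diff[OF assms, of _ ?Q']) simp
    moreover have "?P ?Q' x = ?P (?Q' - Q) x + ?P (Q \<inter> ?Q') x"
      using assms by (subst sum.Int_Diff[of ?Q' _ Q]) (simp_all add: Int_commute)
    ultimately have eq: "?P Q x * (1 - character (axis j 1) (x\<^sub>0 - x)) = ?P (Q - ?Q') x - ?P (?Q' - Q) x"
      by (simp add: algebra_simps)
    have "cmod (?P Q x) * cmod (1 - character (axis j 1) (x\<^sub>0 - x))
        \<le> cmod (?P (Q - ?Q') x) + cmod (?P (?Q' - Q) x)"
      unfolding norm_mult[symmetric] eq by (rule norm_triangle_ineq4)
    then have "(cmod (?P Q x) * cmod (1 - character (axis j 1) (x\<^sub>0 - x)))\<^sup>2
        \<le> (cmod (?P (Q - ?Q') x) + cmod (?P (?Q' - Q) x))\<^sup>2"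
      by (intro power_mono) auto
    \<comment> \<open>The factor 2 here and the equal size of the two boundary layers produce the
      constant 4.\<close>
    also have "\<dots> \<le> 2 * (cmod (?P (Q - ?Q') x))\<^sup>2 + 2 * (cmod (?P (?Q' - Q) x))\<^sup>2"
      using zero_le_power2[of "cmod (?P (Q - ?Q') x) - cmod (?P (?Q' - Q) x)"]
      by (simp add: power2_eq_square algebra_simps)
    finally show ?thesis by (simp add: power_mult_distrib)
  qed
  have "(LINT x|torus. ?f x) \<le>
      (LINT x|torus. 2 * (cmod (?P (Q - ?Q') x))\<^sup>2 + 2 * (cmod (?P (?Q' - Q) x))\<^sup>2)"
    by (intro integral_mono integrable_torus continuous_intros cont le)
  also have "\<dots> = 2 * card (Q - ?Q') + 2 * card (?Q' - Q)"
    using assms by (subst Bochner_Integration.integral_add)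
      (auto intro!: integrable_torus continuous_intros cont simp: integral_torus_sum_character_square)
  finally show ?thesis using card by simp
qed

section \<open>Finite pairings in the sequence space\<close>

lemma ell2_norm_nonneg: "ell2_norm f \<ge> 0"
  by (simp add: ell2_norm_def infsum_nonneg)

lemma finite_support_ell2:
  assumes "finite S" "\<And>k. k \<notin> S \<Longrightarrow> f k = 0"
  shows "f \<in> ell2" and "ell2_norm f = L2_set (\<lambda>k. cmod (f k)) S"
proof -
  have "((\<lambda>k. (cmod (f k))\<^sup>2) has_sum (\<Sum>k\<in>S. (cmod (f k))\<^sup>2)) UNIV"
    using assms by (intro has_sum_finite_neutralI) auto
  then show "f \<in> ell2" "ell2_norm f = L2_set (\<lambda>k. cmod (f k)) S"
    by (auto simp: ell2_def ell2_norm_def L2_set_def infsumI dest: has_sum_imp_summable)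
qed

text \<open>Cauchy-Schwarz on \<open>S\<close>, after which the partial sum for \<open>g\<close> is
  enlarged to its full norm.\<close>

lemma ell2_pairing_le:
  assumes "g \<in> ell2" "finite S"
  shows "cmod (\<Sum>k\<in>S. g k * cnj (f k)) \<le> ell2_norm g * L2_set (\<lambda>k. cmod (f k)) S"
proof -
  have "cmod (\<Sum>k\<in>S. g k * cnj (f k)) \<le> (\<Sum>k\<in>S. cmod (g k) * cmod (f k))"
    by (rule order.trans[OF norm_sum]) (simp add: norm_mult)
  also have "\<dots> \<le> L2_set (\<lambda>k. cmod (g k)) S * L2_set (\<lambda>k. cmod (f k)) S"
    using L2_set_mult_ineq[of "\<lambda>k. cmod (g k)" "\<lambda>k. cmod (f k)" S] by simp
  also have "\<dots> \<le> ell2_norm g * L2_set (\<lambda>k. cmod (f k)) S"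
    using ell2_partial_sum_le[OF assms] by (intro mult_right_mono) auto
  finally show ?thesis .
qed

section \<open>Limits as the lattice point tends to infinity\<close>

lemma znorm_add_le: "znorm (k + l) \<le> znorm k + znorm l"
  by (simp add: znorm_def zvec_add norm_triangle_ineq)

text \<open>By the triangle inequality a fixed shift lowers \<open>znorm\<close> by at most
  \<open>znorm (- m)\<close>, so enlarging the threshold by that amount suffices.\<close>

lemma eventually_znorm_shift:
  assumes "eventually P (filtercomap znorm at_top)"
  shows "eventually (\<lambda>k. P (k + m)) (filtercomap znorm at_top)"
proof -
  obtain N where N: "\<And>k. znorm k \<ge> N \<Longrightarrow> P k"
    using assms by (auto simp: eventually_filtercomap_at_top_linorder)
  have "P (k + m)" if "znorm k \<ge> N + znorm (- m)" for k
    using znorm_add_le[of "k + m" "- m"] that by (intro N) auto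
  then show ?thesis by (auto simp: eventually_filtercomap_at_top_linorder)
qed

lemma eventually_znorm_not_in_finite:
  assumes "finite F"
  shows "eventually (\<lambda>k. k \<notin> F) (filtercomap znorm at_top)"
proof -
  have "k \<notin> F" if "znorm k \<ge> Max (insert 0 (znorm ` F)) + 1" for k
  proof
    assume "k \<in> F"
    then have "znorm k \<le> Max (insert 0 (znorm ` F))" using assms by (intro Max_ge) auto
    with that show False by simp
  qed
  then show ?thesis unfolding eventually_filtercomap_at_top_linorder by blast
qed

text \<open>Some finite \<open>F\<close> carries all but \<open>e\<^sup>2\<close> of the sum of
  squares, so any single term outside \<open>F\<close> is at most \<open>e\<^sup>2\<close>; far out,
  every point is outside \<open>F\<close>.\<close>

lemma eventually_ell2_small:
  assumes h: "h \<in> ell2" and e: "e > 0"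
  shows "eventually (\<lambda>k. cmod (h k) \<le> e) (filtercomap znorm at_top)"
proof -
  let ?g = "\<lambda>k. (cmod (h k))\<^sup>2"
  have sm: "?g summable_on UNIV" using h by (simp add: ell2_def)
  have "eventually (\<lambda>F. dist (sum ?g F) (infsum ?g UNIV) < e\<^sup>2) (finite_subsets_at_top UNIV)"
    using tendstoD[OF infsum_tendsto[OF sm]] e by simp
  then obtain F where F: "finite F" "\<And>G. finite G \<Longrightarrow> F \<subseteq> G \<Longrightarrow> dist (sum ?g G) (infsum ?g UNIV) < e\<^sup>2"
    by (auto simp: eventually_finite_subsets_at_top)
  have "cmod (h k) \<le> e" if "k \<notin> F" for k
  proof -
    have "sum ?g F + ?g k = sum ?g (insert k F)" using that F(1) by simp
    also have "\<dots> \<le> infsum ?g UNIV" by (rule finite_sum_le_infsum) (use sm F(1) in auto)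
    finally have "?g k \<le> e\<^sup>2" using F(2)[OF F(1) order.refl] by (simp add: dist_real_def)
    then show ?thesis using e by (simp add: power2_le_iff_abs_le)
  qed
  then show ?thesis
    by (rule eventually_mono[OF eventually_znorm_not_in_finite[OF F(1)]])
qed

text \<open>The image of the unit ball has a finite \<open>e / 2\<close>-net \<open>H\<close>.
  Replacing \<open>K f\<close> by a nearby \<open>h\<close> costs at most \<open>e / 2\<close> by
  Cauchy-Schwarz, and the finitely many \<open>h\<close> are all small on a far translate of
  \<open>Q\<close>. The bound is uniform in \<open>f\<close>, as needed for packets that depend on
  both \<open>k\<^sub>0\<close> and \<open>x\<^sub>0\<close>.\<close>

lemma compact_operator_pairing_small:
  fixes K :: "(int ^ 'n::finite \<Rightarrow> complex) \<Rightarrow> (int ^ 'n \<Rightarrow> complex)"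
  assumes K: "compact_operator K" and Q: "finite Q" and e: "e > 0"
  shows "\<forall>\<^sub>F k\<^sub>0 in filtercomap znorm at_top. \<forall>f.
      f \<in> ell2 \<longrightarrow> ell2_norm f \<le> 1 \<longrightarrow> cmod (\<Sum>m\<in>Q. K f (k\<^sub>0 + m) * cnj (f (k\<^sub>0 + m))) \<le> e"
proof -
  let ?B = "K ` {f \<in> ell2. ell2_norm f \<le> 1}"
  have "?B \<subseteq> ell2" using K by (auto simp: compact_operator_def)
  moreover have "ell2.mtotally_bounded (ell2.mtopology closure_of ?B)"
    using K by (auto simp: compact_operator_def intro: ell2.compactin_imp_mtotally_bounded)
  ultimately have "ell2.mtotally_bounded ?B"
    using ell2.mtotally_bounded_subset[OF _ closure_of_subset[of ?B ell2.mtopology]] by simp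
  then obtain H where H: "finite H" "H \<subseteq> ?B" "?B \<subseteq> (\<Union>h\<in>H. ell2.mball h (e / 2))"
    using half_gt_zero[OF e] unfolding ell2.mtotally_bounded_def by meson
  \<comment> \<open>Chosen so that \<open>card Q\<close> terms of size \<delta> add up to at most
    \<open>e / 2\<close>; the added 1 keeps the denominator positive.\<close>
  define \<delta> where "\<delta> = e / (2 * (card Q + 1))"
  have \<delta>: "\<delta> > 0" using e by (simp add: \<delta>_def)
  have "\<forall>\<^sub>F k\<^sub>0 in filtercomap znorm at_top. \<forall>h\<in>H. \<forall>m\<in>Q. cmod (h (k\<^sub>0 + m)) \<le> \<delta>"
    using H(2) \<open>?B \<subseteq> ell2\<close> \<delta>
    by (auto intro!: eventually_ball_finite H(1) Q eventually_znorm_shift[OF eventually_ell2_small])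
  then show ?thesis
  proof (rule eventually_mono, intro allI impI)
    fix k\<^sub>0 :: "int ^ 'n" and f :: "int ^ 'n \<Rightarrow> complex"
    assume small: "\<forall>h\<in>H. \<forall>m\<in>Q. cmod (h (k\<^sub>0 + m)) \<le> \<delta>" and f: "f \<in> ell2" "ell2_norm f \<le> 1"
    obtain h where h: "h \<in> H" "K f \<in> ell2.mball h (e / 2)" using H(3) f by blast
    then have hd: "h \<in> ell2" "K f \<in> ell2" "ell2_norm (\<lambda>k. K f k - h k) \<le> e / 2"
      using ell2.commute[of h "K f"] by (auto simp: ell2_dist_def)
    let ?S = "(\<lambda>m. k\<^sub>0 + m) ` Q"
    have S: "(\<Sum>k\<in>?S. g k) = (\<Sum>m\<in>Q. g (k\<^sub>0 + m))" for g :: "_ \<Rightarrow> complex"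
      by (subst sum.reindex) (auto simp: inj_on_def)
    have fS: "L2_set (\<lambda>k. cmod (f k)) ?S \<le> 1"
      using ell2_partial_sum_le[OF f(1), of ?S] f(2) Q by simp
    have f1: "cmod (f k) \<le> 1" for k
      using ell2_partial_sum_le[OF f(1), of "{k}"] f(2) by simp
    have "(\<Sum>m\<in>Q. K f (k\<^sub>0 + m) * cnj (f (k\<^sub>0 + m))) =
        (\<Sum>k\<in>?S. (K f k - h k) * cnj (f k)) + (\<Sum>m\<in>Q. h (k\<^sub>0 + m) * cnj (f (k\<^sub>0 + m)))"
      unfolding S by (simp add: algebra_simps flip: sum.distrib)
    moreover have "cmod (\<Sum>k\<in>?S. (K f k - h k) * cnj (f k)) \<le> (e / 2) * 1"
    proof (rule order.trans[OF ell2_pairing_le])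
      show "ell2_norm (\<lambda>k. K f k - h k) * L2_set (\<lambda>k. cmod (f k)) ?S \<le> (e / 2) * 1"
        by (rule mult_mono) (use hd(3) fS e in \<open>simp_all add: L2_set_nonneg\<close>)
    qed (simp_all add: ell2_diff hd Q)
    moreover have "cmod (\<Sum>m\<in>Q. h (k\<^sub>0 + m) * cnj (f (k\<^sub>0 + m))) \<le> e / 2"
    proof (rule order.trans[OF norm_sum])
      have "(\<Sum>m\<in>Q. cmod (h (k\<^sub>0 + m) * cnj (f (k\<^sub>0 + m)))) \<le> (\<Sum>m\<in>Q. \<delta> * 1)"
        unfolding norm_mult complex_mod_cnj
        by (intro sum_mono mult_mono) (use small h(1) f1 \<delta> in auto)
      also have "\<dots> \<le> e / 2"
        using e by (simp add: \<delta>_def field_simps)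
      finally show "(\<Sum>m\<in>Q. cmod (h (k\<^sub>0 + m) * cnj (f (k\<^sub>0 + m)))) \<le> e / 2" .
    qed
    ultimately show "cmod (\<Sum>m\<in>Q. K f (k\<^sub>0 + m) * cnj (f (k\<^sub>0 + m))) \<le> e"
      using norm_triangle_mono by fastforce
  qed
qed

section \<open>Wave packets\<close>

lemma eventually_finite_supersetI:
  assumes "finite S" "\<And>F. finite F \<Longrightarrow> S \<subseteq> F \<Longrightarrow> P F"
  shows "eventually P (finite_subsets_at_top UNIV)"
  unfolding eventually_finite_subsets_at_top using assms by blast

lemma has_fourier_transform_finite_support:
  assumes S: "finite S" "\<And>k. k \<notin> S \<Longrightarrow> f k = 0"
  shows "has_fourier_transform f (\<lambda>x. \<Sum>k\<in>S. character (- k) x * f k)"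
    (is "has_fourier_transform f ?g")
  unfolding has_fourier_transform_def
proof (intro conjI)
  have cont: "continuous_on UNIV ?g"
    by (intro continuous_intros continuous_on_character)
  show "?g \<in> borel_measurable torus" by (intro borel_measurable_torus cont)
  show "integrable torus (\<lambda>x. (cmod (?g x))\<^sup>2)"
    by (intro integrable_torus continuous_intros cont)
  have "(\<Sum>k\<in>F. character (- k) x * f k) = ?g x" if "finite F" "S \<subseteq> F" for F x
    by (rule sum.mono_neutral_right) (use that S(2) in auto)
  then show "((\<lambda>F. LINT x|torus. (cmod (?g x - (\<Sum>k\<in>F. character (- k) x * f k)))\<^sup>2) \<longlongrightarrow> 0)
      (finite_subsets_at_top UNIV)"
    by (intro tendsto_eventually eventually_finite_supersetI[OF S(1)]) simp
qed

text \<open>The transform is an arbitrary choice of representative, so it can be identified only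
  almost everywhere. The partial sums become constant once the index set contains \<open>S\<close>,
  hence the limit in the definition says that the squared distance to the trigonometric polynomial
  integrates to 0. Measurability is recorded as well because replacing the representative under an
  integral requires it.\<close>

lemma fourier_transform_finite_support:
  assumes S: "finite S" "\<And>k. k \<notin> S \<Longrightarrow> f k = 0"
  shows "fourier_transform f \<in> borel_measurable torus"
    and "AE x in torus. fourier_transform f x = (\<Sum>k\<in>S. character (- k) x * f k)"
proof -
  let ?s = "\<lambda>x. \<Sum>k\<in>S. character (- k) x * f k"
  define g where "g = fourier_transform f"
  have "has_fourier_transform f ?s"
    by (rule has_fourier_transform_finite_support) (use S in auto)
  then have "has_fourier_transform f g"
    unfolding g_def fourier_transform_def by (rule someI[of "has_fourier_transform f"])
  then have g [measurable]: "g \<in> borel_measurable torus"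
    and int: "integrable torus (\<lambda>x. (cmod (g x))\<^sup>2)"
    and lim: "((\<lambda>F. LINT x|torus. (cmod (g x - (\<Sum>k\<in>F. character (- k) x * f k)))\<^sup>2) \<longlongrightarrow> 0)
      (finite_subsets_at_top UNIV)"
    by (simp_all add: has_fourier_transform_def)
  show "fourier_transform f \<in> borel_measurable torus" using g by (simp add: g_def)
  have cont: "continuous_on UNIV ?s"
    by (intro continuous_intros continuous_on_character)
  have s [measurable]: "?s \<in> borel_measurable torus" by (intro borel_measurable_torus cont)
  have "(\<Sum>k\<in>F. character (- k) x * f k) = ?s x" if "finite F" "S \<subseteq> F" for F x
    by (rule sum.mono_neutral_right) (use that S(2) in auto)
  then have "((\<lambda>F. LINT x|torus. (cmod (g x - (\<Sum>k\<in>F. character (- k) x * f k)))\<^sup>2)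
      \<longlongrightarrow> (LINT x|torus. (cmod (g x - ?s x))\<^sup>2)) (finite_subsets_at_top UNIV)"
    by (intro tendsto_eventually eventually_finite_supersetI[OF S(1)]) simp
  then have 0: "(LINT x|torus. (cmod (g x - ?s x))\<^sup>2) = 0"
    using lim by (rule tendsto_unique[OF finite_subsets_at_top_neq_bot])
  \<comment> \<open>Needed because the Bochner integral of a non-integrable function is 0 by
    convention; only for an integrable nonnegative function does a zero integral force it to vanish
    almost everywhere.\<close>
  have "integrable torus (\<lambda>x. (cmod (g x - ?s x))\<^sup>2)"
  proof (rule Bochner_Integration.integrable_bound)
    show "integrable torus (\<lambda>x. 2 * (cmod (g x))\<^sup>2 + 2 * (cmod (?s x))\<^sup>2)"
      by (intro Bochner_Integration.integrable_add integrable_mult_right int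
          integrable_torus continuous_intros cont)
    have "(cmod (g x - ?s x))\<^sup>2 \<le> 2 * (cmod (g x))\<^sup>2 + 2 * (cmod (?s x))\<^sup>2" for x
    proof -
      have "(cmod (g x - ?s x))\<^sup>2 \<le> (cmod (g x) + cmod (?s x))\<^sup>2"
        by (intro power_mono norm_triangle_ineq4) auto
      also have "\<dots> \<le> 2 * (cmod (g x))\<^sup>2 + 2 * (cmod (?s x))\<^sup>2"
        using zero_le_power2[of "cmod (g x) - cmod (?s x)"]
        by (simp add: power2_eq_square algebra_simps)
      finally show ?thesis .
    qed
    then show "AE x in torus. norm ((cmod (g x - ?s x))\<^sup>2)
        \<le> norm (2 * (cmod (g x))\<^sup>2 + 2 * (cmod (?s x))\<^sup>2)"
      by simp
  qed measurable
  then have "AE x in torus. (cmod (g x - ?s x))\<^sup>2 = 0"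
    using 0 by (subst (asm) integral_nonneg_eq_0_iff_AE) auto
  then show "AE x in torus. fourier_transform f x = ?s x"
    by (simp add: g_def)
qed

lemma Op_finite_support:
  assumes S: "finite S" "\<And>k. k \<notin> S \<Longrightarrow> f k = 0" and cont: "continuous_on UNIV (\<sigma> k)"
  shows "Op \<sigma> f k = (LINT x|torus. character k x * \<sigma> k x * (\<Sum>l\<in>S. character (- l) x * f l))"
  unfolding Op_def
proof (rule integral_cong_AE)
  have [measurable]: "\<sigma> k \<in> borel_measurable torus" "character k \<in> borel_measurable torus"
    "(\<lambda>x. \<Sum>l\<in>S. character (- l) x * f l) \<in> borel_measurable torus"
    by (intro borel_measurable_torus cont continuous_intros continuous_on_character)+
  have [measurable]: "fourier_transform f \<in> borel_measurable torus"
    by (rule fourier_transform_finite_support(1)) (fact S)+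
  show "(\<lambda>x. character k x * \<sigma> k x * fourier_transform f x) \<in> borel_measurable torus"
    and "(\<lambda>x. character k x * \<sigma> k x * (\<Sum>l\<in>S. character (- l) x * f l)) \<in> borel_measurable torus"
    by measurable
  have "AE x in torus. fourier_transform f x = (\<Sum>l\<in>S. character (- l) x * f l)"
    by (rule fourier_transform_finite_support(2)) (fact S)+
  then show "AE x in torus. character k x * \<sigma> k x * fourier_transform f x =
      character k x * \<sigma> k x * (\<Sum>l\<in>S. character (- l) x * f l)"
    by eventually_elim simp
qed

text \<open>The phase is taken relative to the centre \<open>k\<^sub>0\<close>, so the values on the
  translate of \<open>Q\<close> depend only on the offset. Up to a unimodular factor, the Fourier
  transform is the sum of \<open>character m (x\<^sub>0 - x)\<close> over \<open>Q\<close>, divided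
  by the normalising root.\<close>

definition wave_packet ::
    "(int ^ 'n::finite) set \<Rightarrow> int ^ 'n \<Rightarrow> real ^ 'n \<Rightarrow> int ^ 'n \<Rightarrow> complex" where
  "wave_packet Q k\<^sub>0 x\<^sub>0 k =
    (if k - k\<^sub>0 \<in> Q then character (k - k\<^sub>0) x\<^sub>0 / of_real (sqrt (card Q)) else 0)"

lemma wave_packet_outside: "k \<notin> (\<lambda>m. k\<^sub>0 + m) ` Q \<Longrightarrow> wave_packet Q k\<^sub>0 x\<^sub>0 k = 0"
  unfolding wave_packet_def by (metis add_diff_cancel_left' add.commute diff_add_cancel imageI)

lemma wave_packet_shift:
  "m \<in> Q \<Longrightarrow> wave_packet Q k\<^sub>0 x\<^sub>0 (k\<^sub>0 + m) = character m x\<^sub>0 / of_real (sqrt (card Q))"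
  by (simp add: wave_packet_def)

lemma sum_translate: "(\<Sum>k\<in>(\<lambda>m. k\<^sub>0 + m) ` Q. g k) = (\<Sum>m\<in>Q. g (k\<^sub>0 + m))"
  for k\<^sub>0 :: "'a::cancel_ab_semigroup_add"
  by (subst sum.reindex) (auto simp: inj_on_def)

lemma
  assumes Q: "finite Q" "Q \<noteq> {}"
  shows wave_packet_ell2: "wave_packet Q k\<^sub>0 x\<^sub>0 \<in> ell2"
    and ell2_norm_wave_packet: "ell2_norm (wave_packet Q k\<^sub>0 x\<^sub>0) = 1"
proof -
  let ?S = "(\<lambda>m. k\<^sub>0 + m) ` Q"
  have S: "finite ?S" using Q by simp
  show "wave_packet Q k\<^sub>0 x\<^sub>0 \<in> ell2"
    by (rule finite_support_ell2(1)[OF S wave_packet_outside])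
  have "(\<Sum>m\<in>Q. (cmod (wave_packet Q k\<^sub>0 x\<^sub>0 (k\<^sub>0 + m)))\<^sup>2) = (\<Sum>m\<in>Q. 1 / card Q)"
    by (intro sum.cong refl)
      (simp add: wave_packet_shift norm_divide norm_character power_divide)
  also have "\<dots> = 1" using Q by simp
  finally show "ell2_norm (wave_packet Q k\<^sub>0 x\<^sub>0) = 1"
    by (subst finite_support_ell2(2)[OF S wave_packet_outside])
      (simp_all add: L2_set_def sum_translate)
qed

text \<open>For a constant symbol the integrand is that constant times the squared modulus of the
  sum over \<open>Q\<close>, whose integral is \<open>card Q\<close>; the formula therefore exhibits
  the pairing as an average of the symbol.\<close>

lemma Op_wave_packet_pairing:
  fixes \<sigma> :: "int ^ 'n::finite \<Rightarrow> real ^ 'n \<Rightarrow> complex"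
  assumes Q: "finite Q" "Q \<noteq> {}" and cont: "\<And>k. continuous_on UNIV (\<sigma> k)"
  shows "(\<Sum>m\<in>Q. Op \<sigma> (wave_packet Q k\<^sub>0 x\<^sub>0) (k\<^sub>0 + m) * cnj (wave_packet Q k\<^sub>0 x\<^sub>0 (k\<^sub>0 + m))) =
    (LINT x|torus. (\<Sum>m\<in>Q. cnj (character m (x\<^sub>0 - x)) * \<sigma> (k\<^sub>0 + m) x) *
      (\<Sum>m\<in>Q. character m (x\<^sub>0 - x))) / card Q"
proof -
  let ?P = "\<lambda>x. \<Sum>l\<in>Q. character l (x\<^sub>0 - x)"
  define r where "r = complex_of_real (sqrt (card Q))"
  have rr: "r * r = of_nat (card Q)"
    unfolding r_def
    by (metis of_nat_0_le_iff of_real_mult of_real_of_nat_eq real_sqrt_mult_self abs_of_nat)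
  have cnj_r: "cnj r = r" by (simp add: r_def)
  have cont_char: "continuous_on UNIV (\<lambda>x. character k (x\<^sub>0 - x))" for k
    by (intro continuous_on_compose2[OF continuous_on_character[of UNIV]] continuous_intros) auto
  have S: "finite ((\<lambda>m. k\<^sub>0 + m) ` Q)" using Q by simp
  have summand: "Op \<sigma> (wave_packet Q k\<^sub>0 x\<^sub>0) (k\<^sub>0 + m) * cnj (wave_packet Q k\<^sub>0 x\<^sub>0 (k\<^sub>0 + m)) =
      (LINT x|torus. cnj (character m (x\<^sub>0 - x)) * \<sigma> (k\<^sub>0 + m) x * ?P x) / card Q"
    if m: "m \<in> Q" for m
  proof -
    \<comment> \<open>The packet is a translate, so its transform carries the conjugate character of
      \<open>k\<^sub>0\<close>. This cancels against the character in \<open>Op\<close>, and the two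
      normalising roots combine to \<open>card Q\<close>.\<close>
    have "(\<Sum>l\<in>(\<lambda>m. k\<^sub>0 + m) ` Q. character (- l) x * wave_packet Q k\<^sub>0 x\<^sub>0 l) =
        cnj (character k\<^sub>0 x) * ?P x / r" for x
      unfolding sum_translate sum_distrib_left sum_divide_distrib
      by (intro sum.cong refl) (simp add: wave_packet_shift r_def character_uminus character_add
          character_diff_right mult_ac del: minus_add_distrib)
    then have "character (k\<^sub>0 + m) x * \<sigma> (k\<^sub>0 + m) x *
        (\<Sum>l\<in>(\<lambda>m. k\<^sub>0 + m) ` Q. character (- l) x * wave_packet Q k\<^sub>0 x\<^sub>0 l) *
          (cnj (character m x\<^sub>0) / r) =
        (cnj (character k\<^sub>0 x) * character k\<^sub>0 x) *
          (cnj (character m (x\<^sub>0 - x)) * \<sigma> (k\<^sub>0 + m) x * ?P x) / (r * r)" for x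
      by (simp add: character_add character_diff_right mult_ac)
    then have "character (k\<^sub>0 + m) x * \<sigma> (k\<^sub>0 + m) x *
        (\<Sum>l\<in>(\<lambda>m. k\<^sub>0 + m) ` Q. character (- l) x * wave_packet Q k\<^sub>0 x\<^sub>0 l) *
          (cnj (character m x\<^sub>0) / r) =
        (cnj (character m (x\<^sub>0 - x)) * \<sigma> (k\<^sub>0 + m) x * ?P x) / card Q" for x
      by (simp only: character_cnj_mult rr mult_1_left)
    then show ?thesis
      by (subst Op_finite_support[OF S wave_packet_outside cont])
        (simp_all add: wave_packet_shift[OF m] cnj_r flip: r_def integral_mult_left_zero
          integral_divide_zero)
  qed
  have "(\<Sum>m\<in>Q. Op \<sigma> (wave_packet Q k\<^sub>0 x\<^sub>0) (k\<^sub>0 + m) * cnj (wave_packet Q k\<^sub>0 x\<^sub>0 (k\<^sub>0 + m))) =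
      (\<Sum>m\<in>Q. LINT x|torus. cnj (character m (x\<^sub>0 - x)) * \<sigma> (k\<^sub>0 + m) x * ?P x) / card Q"
    by (simp add: summand sum_divide_distrib)
  also have "(\<Sum>m\<in>Q. LINT x|torus. cnj (character m (x\<^sub>0 - x)) * \<sigma> (k\<^sub>0 + m) x * ?P x) =
      (LINT x|torus. (\<Sum>m\<in>Q. cnj (character m (x\<^sub>0 - x)) * \<sigma> (k\<^sub>0 + m) x * ?P x))"
    by (intro Bochner_Integration.integral_sum[symmetric] integrable_torus continuous_intros
        cont cont_char)
  finally show ?thesis by (simp only: sum_distrib_right)
qed

section \<open>The lower bound for slowly varying symbols\<close>

text \<open>Two replacements are made. Freezing the lattice variable at \<open>k\<^sub>0\<close>
  costs at most \<open>card Q * d\<close>, since both sums over \<open>Q\<close> have trivial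
  bounds. Freezing \<open>x\<close> at \<open>x\<^sub>0\<close> costs \<open>near_x\<close>
  integrated against the squared modulus of the packet sum: its constant part returns
  \<open>e\<close>, and its quadratic part is controlled by
  \<open>integral_torus_concentration\<close>.\<close>

lemma wave_packet_estimate:
  fixes \<sigma> :: "int ^ 'n::finite \<Rightarrow> real ^ 'n \<Rightarrow> complex" and Q :: "(int ^ 'n) set" and d e A :: real
  assumes Q: "finite Q" "Q \<noteq> {}" and cont: "\<And>k. continuous_on UNIV (\<sigma> k)"
    and near_k: "\<And>m x. m \<in> Q \<Longrightarrow> cmod (\<sigma> (k\<^sub>0 + m) x - \<sigma> k\<^sub>0 x) \<le> d"
    and near_x: "\<And>x. cmod (\<sigma> k\<^sub>0 x - \<sigma> k\<^sub>0 x\<^sub>0) \<le>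
      e + A * (\<Sum>j\<in>UNIV. (cmod (1 - character (axis j 1) (x\<^sub>0 - x)))\<^sup>2)"
    and A: "A \<ge> 0"
  shows "cmod ((\<Sum>m\<in>Q. Op \<sigma> (wave_packet Q k\<^sub>0 x\<^sub>0) (k\<^sub>0 + m) * cnj (wave_packet Q k\<^sub>0 x\<^sub>0 (k\<^sub>0 + m)))
      - \<sigma> k\<^sub>0 x\<^sub>0) \<le> card Q * d + e +
        A * (\<Sum>j\<in>UNIV. 4 * card (Q - (\<lambda>k. k + axis j 1) ` Q)) / card Q"
proof -
  let ?\<chi> = "\<lambda>m x. character m (x\<^sub>0 - x)"
  let ?P = "\<lambda>x. \<Sum>m\<in>Q. ?\<chi> m x"
  let ?G = "\<lambda>x. (\<Sum>m\<in>Q. cnj (?\<chi> m x) * \<sigma> (k\<^sub>0 + m) x) * ?P x"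
  let ?t = "\<lambda>j x. (cmod (1 - ?\<chi> (axis j 1) x))\<^sup>2"
  define q where "q = real (card Q)"
  have q: "q > 0" using Q by (simp add: q_def card_gt_0_iff)
  have cont_char: "continuous_on UNIV (?\<chi> k)" for k
    by (intro continuous_on_compose2[OF continuous_on_character[of UNIV]] continuous_intros) auto
  have P_le: "cmod (?P x) \<le> q" for x
    by (rule order.trans[OF norm_sum]) (simp add: norm_character q_def)
  have int_P: "(LINT x|torus. (cmod (?P x))\<^sup>2) = q"
    using integral_torus_sum_character_square[OF Q(1)] by (simp add: q_def)
  have pointwise: "cmod (?G x - \<sigma> k\<^sub>0 x\<^sub>0 * of_real ((cmod (?P x))\<^sup>2)) \<le>
      q * q * d + (e * (cmod (?P x))\<^sup>2 + (\<Sum>j\<in>UNIV. A * ((cmod (?P x))\<^sup>2 * ?t j x)))" for x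
  proof -
    have "complex_of_real ((cmod (?P x))\<^sup>2) = cnj (?P x) * ?P x"
      by (simp only: complex_norm_square mult.commute)
    \<comment> \<open>The value of the symbol at \<open>(k\<^sub>0, x)\<close> times the squared
      modulus is added and subtracted.\<close>
    then have eq: "?G x - \<sigma> k\<^sub>0 x\<^sub>0 * of_real ((cmod (?P x))\<^sup>2) =
        (\<Sum>m\<in>Q. cnj (?\<chi> m x) * (\<sigma> (k\<^sub>0 + m) x - \<sigma> k\<^sub>0 x)) * ?P x +
        (\<sigma> k\<^sub>0 x - \<sigma> k\<^sub>0 x\<^sub>0) * of_real ((cmod (?P x))\<^sup>2)"
      by (simp add: algebra_simps sum_subtractf sum_distrib_left)
    have "cmod (?G x - \<sigma> k\<^sub>0 x\<^sub>0 * of_real ((cmod (?P x))\<^sup>2)) \<le>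
        cmod (\<Sum>m\<in>Q. cnj (?\<chi> m x) * (\<sigma> (k\<^sub>0 + m) x - \<sigma> k\<^sub>0 x)) * cmod (?P x) +
        cmod (\<sigma> k\<^sub>0 x - \<sigma> k\<^sub>0 x\<^sub>0) * (cmod (?P x))\<^sup>2"
      unfolding eq by (rule order.trans[OF norm_triangle_ineq]) (simp add: norm_mult norm_power)
    moreover have "cmod (\<Sum>m\<in>Q. cnj (?\<chi> m x) * (\<sigma> (k\<^sub>0 + m) x - \<sigma> k\<^sub>0 x)) * cmod (?P x) \<le> (q * d) * q"
    proof (rule mult_mono)
      have "cmod (\<Sum>m\<in>Q. cnj (?\<chi> m x) * (\<sigma> (k\<^sub>0 + m) x - \<sigma> k\<^sub>0 x)) \<le> (\<Sum>m\<in>Q. d)"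
        using near_k by (intro sum_norm_le) (simp add: norm_mult norm_character)
      then show "cmod (\<Sum>m\<in>Q. cnj (?\<chi> m x) * (\<sigma> (k\<^sub>0 + m) x - \<sigma> k\<^sub>0 x)) \<le> q * d"
        by (simp add: q_def)
      then show "0 \<le> q * d" using norm_ge_zero order.trans by blast
    qed (simp_all add: P_le)
    moreover have "cmod (\<sigma> k\<^sub>0 x - \<sigma> k\<^sub>0 x\<^sub>0) * (cmod (?P x))\<^sup>2 \<le>
        (e + A * (\<Sum>j\<in>UNIV. ?t j x)) * (cmod (?P x))\<^sup>2"
      by (intro mult_right_mono near_x) simp
    moreover have "(e + A * (\<Sum>j\<in>UNIV. ?t j x)) * (cmod (?P x))\<^sup>2 =
        e * (cmod (?P x))\<^sup>2 + (\<Sum>j\<in>UNIV. A * ((cmod (?P x))\<^sup>2 * ?t j x))"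
      by (simp add: algebra_simps sum_distrib_left)
    ultimately show ?thesis by (simp add: mult_ac)
  qed
  have int_G: "integrable torus ?G"
    by (intro integrable_torus continuous_intros cont cont_char)
  have int_PP: "integrable torus (\<lambda>x. (cmod (?P x))\<^sup>2)"
    by (intro integrable_torus continuous_intros cont_char)
  have int_t: "integrable torus (\<lambda>x. (cmod (?P x))\<^sup>2 * ?t j x)" for j
    by (intro integrable_torus continuous_intros cont_char)
  have int_c: "integrable (torus :: (real ^ 'n) measure) (\<lambda>x. c)" for c :: real
    by (intro integrable_torus continuous_intros)
  \<comment> \<open>Parseval for the single frequency 0 gives the total mass of the torus.\<close>
  have vol: "measure (torus :: (real ^ 'n) measure) (space torus) = 1"
    using integral_torus_norm_square[of "{0 :: int ^ 'n}" "\<lambda>_. 1"]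
    by (simp add: character_0)
  have sum_eq: "(\<Sum>m\<in>Q. Op \<sigma> (wave_packet Q k\<^sub>0 x\<^sub>0) (k\<^sub>0 + m) * cnj (wave_packet Q k\<^sub>0 x\<^sub>0 (k\<^sub>0 + m)))
      = (LINT x|torus. ?G x) / q"
    unfolding Op_wave_packet_pairing[OF Q cont] by (simp add: q_def)
  have int_diff: "(LINT x|torus. ?G x - \<sigma> k\<^sub>0 x\<^sub>0 * of_real ((cmod (?P x))\<^sup>2)) =
      (LINT x|torus. ?G x) - \<sigma> k\<^sub>0 x\<^sub>0 * of_real q"
    by (subst Bochner_Integration.integral_diff[OF int_G])
      (simp_all only: integral_mult_right_zero integral_complex_of_real int_P
        integrable_mult_right integrable_of_real int_PP)
  have "cmod ((LINT x|torus. ?G x) - \<sigma> k\<^sub>0 x\<^sub>0 * of_real q) \<le>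
      (LINT x|torus. cmod (?G x - \<sigma> k\<^sub>0 x\<^sub>0 * of_real ((cmod (?P x))\<^sup>2)))"
    unfolding int_diff[symmetric] by (rule integral_norm_bound)
  also have "\<dots> \<le> (LINT x|torus. q * q * d + (e * (cmod (?P x))\<^sup>2 +
      (\<Sum>j\<in>UNIV. A * ((cmod (?P x))\<^sup>2 * ?t j x))))"
    by (intro integral_mono pointwise integrable_torus continuous_intros cont cont_char)
  also have "\<dots> = q * q * d + (e * q +
      (\<Sum>j\<in>UNIV. A * (LINT x|torus. (cmod (?P x))\<^sup>2 * ?t j x)))"
    using int_PP int_t int_c by (simp add: int_P vol)
  also have "\<dots> \<le> q * q * d + (e * q +
      (\<Sum>j\<in>UNIV. A * real (4 * card (Q - (\<lambda>k. k + axis j 1) ` Q))))"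
    by (intro add_left_mono sum_mono mult_left_mono A integral_torus_concentration Q)
  finally have "cmod ((LINT x|torus. ?G x) - \<sigma> k\<^sub>0 x\<^sub>0 * of_real q) / q \<le> (q * q * d + (e * q +
      (\<Sum>j\<in>UNIV. A * real (4 * card (Q - (\<lambda>k. k + axis j 1) ` Q))))) / q"
    using q by (intro divide_right_mono) auto
  also have "\<dots> = q * d + e + A * (\<Sum>j\<in>UNIV. 4 * card (Q - (\<lambda>k. k + axis j 1) ` Q)) / q"
    using q by (simp add: field_simps sum_distrib_left)
  also have "cmod ((LINT x|torus. ?G x) - \<sigma> k\<^sub>0 x\<^sub>0 * of_real q) / q =
      cmod (((LINT x|torus. ?G x) - \<sigma> k\<^sub>0 x\<^sub>0 * of_real q) / of_real q)"
    using q by (simp add: norm_divide)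
  also have "((LINT x|torus. ?G x) - \<sigma> k\<^sub>0 x\<^sub>0 * of_real q) / of_real q =
      (LINT x|torus. ?G x) / q - \<sigma> k\<^sub>0 x\<^sub>0"
    using q by (simp add: field_simps)
  finally show ?thesis unfolding sum_eq q_def .
qed

text \<open>Completing the square. It trades a modulus of continuity that is linear in
  \<open>t\<close> for a quadratic term, which is what the concentration estimate controls.\<close>

lemma linear_le_const_plus_square:
  fixes t :: real
  assumes "d > 0"
  shows "B * t \<le> d + B\<^sup>2 / (4 * d) * t\<^sup>2"
proof -
  have "(2 * d - B * t)\<^sup>2 / (4 * d) \<ge> 0" using assms by simp
  then show ?thesis using assms by (simp add: field_simps power2_eq_square)
qed

section \<open>Slow variation of the symbol in the lattice variable\<close>

definition slowly_varying :: "(int ^ 'n::finite \<Rightarrow> real ^ 'n \<Rightarrow> complex) \<Rightarrow> int ^ 'n \<Rightarrow> bool" where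
  "slowly_varying \<sigma> m \<longleftrightarrow> (\<forall>e>0. \<forall>\<^sub>F k in filtercomap znorm at_top.
     \<forall>x. cmod (\<sigma> (k + m) x - \<sigma> k x) \<le> e)"

lemma slowly_varying_0: "slowly_varying \<sigma> 0"
  by (simp add: slowly_varying_def)

text \<open>The difference for \<open>- m\<close> at \<open>k\<close> is the negative of the
  difference for \<open>m\<close> at \<open>k - m\<close>.\<close>

lemma slowly_varying_uminus:
  assumes "slowly_varying \<sigma> m"
  shows "slowly_varying \<sigma> (- m)"
  unfolding slowly_varying_def
proof (intro allI impI)
  fix e :: real assume "e > 0"
  then have "\<forall>\<^sub>F k in filtercomap znorm at_top. \<forall>x. cmod (\<sigma> (k + m) x - \<sigma> k x) \<le> e"
    using assms by (simp add: slowly_varying_def)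
  then have "\<forall>\<^sub>F k in filtercomap znorm at_top.
      \<forall>x. cmod (\<sigma> (k + - m + m) x - \<sigma> (k + - m) x) \<le> e"
    by (rule eventually_znorm_shift)
  then show "\<forall>\<^sub>F k in filtercomap znorm at_top. \<forall>x. cmod (\<sigma> (k + - m) x - \<sigma> k x) \<le> e"
    by (simp add: norm_minus_commute)
qed

lemma slowly_varying_add:
  assumes "slowly_varying \<sigma> m" "slowly_varying \<sigma> m'"
  shows "slowly_varying \<sigma> (m + m')"
  unfolding slowly_varying_def
proof (intro allI impI)
  fix e :: real assume "e > 0"
  then have "e / 2 > 0" by simp
  then have 1: "\<forall>\<^sub>F k in filtercomap znorm at_top. \<forall>x. cmod (\<sigma> (k + m) x - \<sigma> k x) \<le> e / 2"
    and 2: "\<forall>\<^sub>F k in filtercomap znorm at_top. \<forall>x. cmod (\<sigma> (k + m') x - \<sigma> k x) \<le> e / 2"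
    using assms unfolding slowly_varying_def by blast+
  show "\<forall>\<^sub>F k in filtercomap znorm at_top. \<forall>x. cmod (\<sigma> (k + (m + m')) x - \<sigma> k x) \<le> e"
    using 1 eventually_znorm_shift[OF 2, of m]
  proof eventually_elim
    case (elim k)
    show ?case
    proof
      fix x
      show "cmod (\<sigma> (k + (m + m')) x - \<sigma> k x) \<le> e"
        using norm_triangle_ineq[of "\<sigma> (k + m + m') x - \<sigma> (k + m) x" "\<sigma> (k + m) x - \<sigma> k x"]
          elim(1)[rule_format, of x] elim(2)[rule_format, of x]
        by (simp add: add.assoc)
    qed
  qed
qed

text \<open>The shifts along which a symbol varies slowly form a subgroup, and the unit vectors
  generate the whole lattice.\<close>

lemma slowly_varying_of_axis:
  fixes m :: "int ^ 'n::finite"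
  assumes axis: "\<And>j. slowly_varying \<sigma> (axis j 1)"
  shows "slowly_varying \<sigma> m"
proof -
  have nat: "slowly_varying \<sigma> (axis j (int t))" for j t
  proof (induction t)
    case 0
    have "axis j 0 = (0 :: int ^ 'n)" by (simp add: axis_def vec_eq_iff)
    then show ?case by (simp only: of_nat_0 slowly_varying_0)
  next
    case (Suc t)
    have "axis j (int (Suc t)) = axis j (int t) + (axis j 1 :: int ^ 'n)"
      by (simp add: axis_def vec_eq_iff)
    then show ?case using slowly_varying_add[OF Suc axis] by simp
  qed
  have int: "slowly_varying \<sigma> (axis j t)" for j t
  proof (cases "t \<ge> 0")
    case True
    then show ?thesis using nat[of j "nat t"] by simp
  next
    case False
    have "axis j t = - (axis j (- t) :: int ^ 'n)" by (simp add: axis_def vec_eq_iff)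
    then show ?thesis using slowly_varying_uminus[OF nat[of j "nat (- t)"]] False by simp
  qed
  have "slowly_varying \<sigma> (\<Sum>j\<in>J. axis j (m $ j))" if "finite J" for J
    using that by induction (auto intro: slowly_varying_0 slowly_varying_add int)
  from this[of UNIV] have "slowly_varying \<sigma> (\<Sum>j\<in>UNIV. axis j (m $ j))" by simp
  also have "(\<Sum>j\<in>UNIV. axis j (m $ j)) = m"
    by (simp add: vec_eq_iff axis_def)
  finally show ?thesis .
qed

text \<open>The set \<open>Q\<close> is fixed before \<open>k\<^sub>0\<close>, so slow variation is
  required only for finitely many shifts. The error \<open>e\<close> is split into three equal
  parts: variation in the lattice variable, the constant part of the modulus of continuity, and the
  boundary of \<open>Q\<close>.\<close>

lemma wave_packets_asymptotic:
  fixes \<sigma> :: "int ^ 'n::finite \<Rightarrow> real ^ 'n \<Rightarrow> complex"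
  assumes cont: "\<And>k. continuous_on UNIV (\<sigma> k)"
    and modulus: "\<And>k x y. cmod (\<sigma> k x - \<sigma> k y) \<le>
      B * (\<Sum>j\<in>UNIV. cmod (1 - character (axis j 1) (y - x)))"
    and slow: "\<And>j. slowly_varying \<sigma> (axis j 1)"
    and e: "e > 0"
  obtains Q where "finite Q" "Q \<noteq> {}"
    "\<forall>\<^sub>F k\<^sub>0 in filtercomap znorm at_top. \<forall>x\<^sub>0.
      cmod ((\<Sum>m\<in>Q. Op \<sigma> (wave_packet Q k\<^sub>0 x\<^sub>0) (k\<^sub>0 + m) * cnj (wave_packet Q k\<^sub>0 x\<^sub>0 (k\<^sub>0 + m)))
        - \<sigma> k\<^sub>0 x\<^sub>0) \<le> e"
proof -
  define n where "n = real CARD('n)"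
  have n: "n > 0" by (simp add: n_def)
  \<comment> \<open>The constant of \<open>linear_le_const_plus_square\<close> for
    \<open>d = e / (3 * n)\<close>; the \<open>n\<close> constant terms then add up to
    \<open>e / 3\<close>.\<close>
  define A where "A = B\<^sup>2 / (4 * (e / (3 * n)))"
  have A: "A \<ge> 0" using e n by (simp add: A_def)
  \<comment> \<open>The boundary contributes at most \<open>4 * A * n / N\<close>, and this choice
    makes it at most \<open>e / 3\<close>.\<close>
  obtain N :: nat where N: "N > 0" "N \<ge> 12 * A * n / e"
    by (metis gr0I less_nat_zero_code max.cobounded1 max.cobounded2 of_nat_mono order.trans
        real_arch_simple zero_less_Suc le_SucI)
  obtain Q :: "(int ^ 'n) set" where Q: "finite Q" "Q \<noteq> {}"
    "\<And>j. N * card (Q - (\<lambda>k. k + axis j 1) ` Q) \<le> card Q"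
    using exists_almost_invariant_set[OF N(1)] by blast
  define q where "q = real (card Q)"
  have q: "q > 0" using Q by (simp add: q_def card_gt_0_iff)
  have near_x: "cmod (\<sigma> k x - \<sigma> k y) \<le>
      e / 3 + A * (\<Sum>j\<in>UNIV. (cmod (1 - character (axis j 1) (y - x)))\<^sup>2)" for k x y
  proof -
    have "cmod (\<sigma> k x - \<sigma> k y) \<le> (\<Sum>j\<in>UNIV. B * cmod (1 - character (axis j 1) (y - x)))"
      using modulus[of k x y] by (simp add: sum_distrib_left)
    also have "\<dots> \<le> (\<Sum>j\<in>UNIV. e / (3 * n) + A * (cmod (1 - character (axis j 1) (y - x)))\<^sup>2)"
      unfolding A_def using e n by (intro sum_mono linear_le_const_plus_square) simp
    also have "\<dots> = e / 3 + A * (\<Sum>j\<in>UNIV. (cmod (1 - character (axis j 1) (y - x)))\<^sup>2)"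
      using n by (simp add: sum.distrib sum_distrib_left n_def)
    finally show ?thesis .
  qed
  have boundary: "A * (\<Sum>j\<in>UNIV. 4 * card (Q - (\<lambda>k. k + axis j 1) ` Q)) / q \<le> e / 3"
  proof -
    have "real (card (Q - (\<lambda>k. k + axis j 1) ` Q)) \<le> q / N" for j
      using Q(3)[of j] N(1) by (simp add: q_def field_simps flip: of_nat_mult)
    then have "(\<Sum>j\<in>(UNIV :: 'n set). 4 * real (card (Q - (\<lambda>k. k + axis j 1) ` Q))) \<le>
        (\<Sum>j\<in>(UNIV :: 'n set). 4 * (q / N))"
      by (intro sum_mono mult_left_mono) auto
    then have "A * (\<Sum>j\<in>UNIV. 4 * card (Q - (\<lambda>k. k + axis j 1) ` Q)) / q \<le> A * (n * (4 * (q / N))) / q"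
      using A q by (intro divide_right_mono mult_left_mono) (auto simp: n_def)
    also have "\<dots> = 4 * A * n / N" using q by simp
    also have "\<dots> \<le> e / 3" using N e by (simp add: field_simps)
    finally show ?thesis .
  qed
  \<comment> \<open>The tolerance is divided by \<open>q\<close> because
    \<open>wave_packet_estimate\<close> multiplies it by \<open>card Q\<close>.\<close>
  have "\<forall>\<^sub>F k\<^sub>0 in filtercomap znorm at_top. \<forall>m\<in>Q. \<forall>x. cmod (\<sigma> (k\<^sub>0 + m) x - \<sigma> k\<^sub>0 x) \<le> e / (3 * q)"
  proof (rule eventually_ball_finite[OF Q(1)], rule ballI)
    fix m
    have "e / (3 * q) > 0" using e q by simp
    then show "\<forall>\<^sub>F k\<^sub>0 in filtercomap znorm at_top. \<forall>x. cmod (\<sigma> (k\<^sub>0 + m) x - \<sigma> k\<^sub>0 x) \<le> e / (3 * q)"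
      using slowly_varying_of_axis[OF slow, of m] unfolding slowly_varying_def by blast
  qed
  then have "\<forall>\<^sub>F k\<^sub>0 in filtercomap znorm at_top. \<forall>x\<^sub>0.
      cmod ((\<Sum>m\<in>Q. Op \<sigma> (wave_packet Q k\<^sub>0 x\<^sub>0) (k\<^sub>0 + m) * cnj (wave_packet Q k\<^sub>0 x\<^sub>0 (k\<^sub>0 + m)))
        - \<sigma> k\<^sub>0 x\<^sub>0) \<le> e"
  proof (rule eventually_mono, intro allI)
    fix k\<^sub>0 x\<^sub>0
    assume near_k: "\<forall>m\<in>Q. \<forall>x. cmod (\<sigma> (k\<^sub>0 + m) x - \<sigma> k\<^sub>0 x) \<le> e / (3 * q)"
    have "cmod ((\<Sum>m\<in>Q. Op \<sigma> (wave_packet Q k\<^sub>0 x\<^sub>0) (k\<^sub>0 + m) * cnj (wave_packet Q k\<^sub>0 x\<^sub>0 (k\<^sub>0 + m)))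
        - \<sigma> k\<^sub>0 x\<^sub>0) \<le> card Q * (e / (3 * q)) + e / 3 +
        A * (\<Sum>j\<in>UNIV. 4 * card (Q - (\<lambda>k. k + axis j 1) ` Q)) / card Q"
      by (rule wave_packet_estimate[OF Q(1,2) cont]) (use near_k near_x A in auto)
    also have "card Q * (e / (3 * q)) = e / 3" using q by (simp add: q_def)
    finally show "cmod ((\<Sum>m\<in>Q. Op \<sigma> (wave_packet Q k\<^sub>0 x\<^sub>0) (k\<^sub>0 + m) *
        cnj (wave_packet Q k\<^sub>0 x\<^sub>0 (k\<^sub>0 + m))) - \<sigma> k\<^sub>0 x\<^sub>0) \<le> e"
      using boundary unfolding q_def by linarith
  qed
  with Q(1,2) show thesis by (rule that)
qed

section \<open>From pairings to the operator norm\<close>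

lemma ell2_operator_norm_pairing_le:
  assumes f: "f \<in> ell2" "ell2_norm f \<le> 1" and S: "finite S"
  shows "ereal (cmod (\<Sum>k\<in>S. A f k * cnj (f k))) \<le> ell2_operator_norm A"
proof -
  have "ereal (cmod (\<Sum>k\<in>S. A f k * cnj (f k))) \<le>
      (if A f \<in> ell2 then ereal (ell2_norm (A f)) else \<infinity>)"
  \<comment> \<open>If \<open>A f\<close> leaves the sequence space, the right-hand side is infinite
    and the bound is trivial.\<close>
  proof (cases "A f \<in> ell2")
    case True
    have "cmod (\<Sum>k\<in>S. A f k * cnj (f k)) \<le> ell2_norm (A f) * L2_set (\<lambda>k. cmod (f k)) S"
      by (rule ell2_pairing_le[OF True S])
    also have "\<dots> \<le> ell2_norm (A f) * 1"
      using ell2_partial_sum_le[OF f(1) S] f(2) by (intro mult_left_mono ell2_norm_nonneg) simp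
    finally show ?thesis using True by simp
  qed simp
  also have "\<dots> \<le> ell2_operator_norm A"
    unfolding ell2_operator_norm_def using f by (intro SUP_upper) simp
  finally show ?thesis .
qed

lemma norm_perturbation: "norm s \<le> norm (x - y) + norm (x - s) + norm y"
  for s :: "'a::real_normed_vector"
proof -
  have "norm s = norm ((x - y) + (y - (x - s)))" by simp
  also have "\<dots> \<le> norm (x - y) + (norm y + norm (x - s))"
    by (rule norm_triangle_mono[OF order.refl norm_triangle_ineq4])
  finally show ?thesis by simp
qed

text \<open>Far out, each symbol value is within \<open>e / 2\<close> of the pairing of
  \<open>Op \<sigma> f\<close> with its packet \<open>f\<close>, while the pairing of
  \<open>K f\<close> is at most \<open>e / 2\<close>. Both bounds hold for the same \<open>Q\<close>
  and uniformly in \<open>x\<^sub>0\<close>, so the supremum over \<open>x\<^sub>0\<close> can be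
  taken before the upper limit.\<close>

theorem Limsup_symbol_le_operator_norm:
  fixes \<sigma> :: "int ^ 'n::finite \<Rightarrow> real ^ 'n \<Rightarrow> complex"
  assumes K: "compact_operator K" and cont: "\<And>k. continuous_on UNIV (\<sigma> k)"
    and modulus: "\<And>k x y. cmod (\<sigma> k x - \<sigma> k y) \<le>
      B * (\<Sum>j\<in>UNIV. cmod (1 - character (axis j 1) (y - x)))"
    and slow: "\<And>j. slowly_varying \<sigma> (axis j 1)"
  shows "Limsup (filtercomap znorm at_top) (\<lambda>k. SUP x. ereal (cmod (\<sigma> k x)))
    \<le> ell2_operator_norm (\<lambda>f k. Op \<sigma> f k - K f k)" (is "_ \<le> ?M")
proof (rule ereal_le_epsilon2)
  fix e :: real assume "e > 0"
  then have e: "e / 2 > 0" by simp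
  obtain Q :: "(int ^ 'n) set" where Q: "finite Q" "Q \<noteq> {}"
    and Op: "\<forall>\<^sub>F k\<^sub>0 in filtercomap znorm at_top. \<forall>x\<^sub>0.
      cmod ((\<Sum>m\<in>Q. Op \<sigma> (wave_packet Q k\<^sub>0 x\<^sub>0) (k\<^sub>0 + m) * cnj (wave_packet Q k\<^sub>0 x\<^sub>0 (k\<^sub>0 + m)))
        - \<sigma> k\<^sub>0 x\<^sub>0) \<le> e / 2"
    using wave_packets_asymptotic[OF cont modulus slow e] .
  show "Limsup (filtercomap znorm at_top) (\<lambda>k. SUP x. ereal (cmod (\<sigma> k x))) \<le> ?M + ereal e"
  proof (rule Limsup_bounded)
    show "\<forall>\<^sub>F k in filtercomap znorm at_top. (SUP x. ereal (cmod (\<sigma> k x))) \<le> ?M + ereal e"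
      using Op compact_operator_pairing_small[OF K Q(1) e]
    proof (rule eventually_elim2, intro SUP_least)
      fix k\<^sub>0 x\<^sub>0
      let ?f = "wave_packet Q k\<^sub>0 x\<^sub>0"
      let ?pair = "\<lambda>g. \<Sum>m\<in>Q. g (k\<^sub>0 + m) * cnj (?f (k\<^sub>0 + m))"
      assume Op': "\<forall>x\<^sub>0. cmod ((\<Sum>m\<in>Q. Op \<sigma> (wave_packet Q k\<^sub>0 x\<^sub>0) (k\<^sub>0 + m) *
          cnj (wave_packet Q k\<^sub>0 x\<^sub>0 (k\<^sub>0 + m))) - \<sigma> k\<^sub>0 x\<^sub>0) \<le> e / 2"
        and K': "\<forall>f. f \<in> ell2 \<longrightarrow> ell2_norm f \<le> 1 \<longrightarrow>
          cmod (\<Sum>m\<in>Q. K f (k\<^sub>0 + m) * cnj (f (k\<^sub>0 + m))) \<le> e / 2"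
      have f: "?f \<in> ell2" "ell2_norm ?f \<le> 1"
        using wave_packet_ell2[OF Q] ell2_norm_wave_packet[OF Q] by simp_all
      have "cmod (?pair (Op \<sigma> ?f) - \<sigma> k\<^sub>0 x\<^sub>0) \<le> e / 2" using Op' by blast
      moreover have "cmod (?pair (K ?f)) \<le> e / 2" using K' f by blast
      moreover have "?pair (\<lambda>k. Op \<sigma> ?f k - K ?f k) = ?pair (Op \<sigma> ?f) - ?pair (K ?f)"
        by (simp add: left_diff_distrib sum_subtractf)
      ultimately have le: "cmod (\<sigma> k\<^sub>0 x\<^sub>0) \<le> cmod (?pair (\<lambda>k. Op \<sigma> ?f k - K ?f k)) + e"
        using norm_perturbation[of "\<sigma> k\<^sub>0 x\<^sub>0" "?pair (Op \<sigma> ?f)" "?pair (K ?f)"] by simp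
      have "ereal (cmod (?pair (\<lambda>k. Op \<sigma> ?f k - K ?f k))) \<le> ?M"
        using ell2_operator_norm_pairing_le[OF f, of "(\<lambda>m. k\<^sub>0 + m) ` Q" "\<lambda>f k. Op \<sigma> f k - K f k"]
        by (simp add: sum_translate Q)
      then have "ereal (cmod (?pair (\<lambda>k. Op \<sigma> ?f k - K ?f k))) + ereal e \<le> ?M + ereal e"
        by (rule add_right_mono)
      moreover have "ereal (cmod (\<sigma> k\<^sub>0 x\<^sub>0)) \<le> ereal (cmod (?pair (\<lambda>k. Op \<sigma> ?f k - K ?f k))) + ereal e"
        using le by simp
      ultimately show "ereal (cmod (\<sigma> k\<^sub>0 x\<^sub>0)) \<le> ?M + ereal e" by (rule order.trans[rotated])
    qed
  qed
qed

section \<open>Symbols with bounded derivatives\<close>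

text \<open>For \<open>x = pi * \<bar>t\<bar>\<close>, which is at most 2, the third-order Taylor
  bound gives \<open>sin x \<ge> x - x ^ 3 / 6 \<ge> x / 3\<close>. Combined with
  \<open>pi \<ge> 2\<close>, this is more than enough for the stated constant.\<close>

lemma half_abs_le_abs_sin:
  assumes "\<bar>t\<bar> \<le> 1 / 2"
  shows "\<bar>t\<bar> \<le> 2 * \<bar>sin (pi * t)\<bar>"
proof -
  define x where "x = pi * \<bar>t\<bar>"
  have x0: "0 \<le> x" by (simp add: x_def)
  have "x \<le> pi * (1 / 2)" unfolding x_def using assms by (intro mult_left_mono) auto
  then have x2: "x \<le> 2" using pi_less_4 by simp
  have bound: "\<bar>sin x - (\<Sum>m<3. sin_coeff m * x ^ m)\<bar> \<le> inverse (fact 3) * \<bar>x\<bar> ^ 3"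
    by (rule Maclaurin_sin_bound)
  have "(\<Sum>m<3. sin_coeff m * x ^ m) = x"
    by (simp add: eval_nat_numeral sin_coeff_def)
  moreover have "inverse (fact 3) * \<bar>x\<bar> ^ 3 = x ^ 3 / 6"
    using x0 by (simp add: eval_nat_numeral)
  ultimately have "\<bar>sin x - x\<bar> \<le> x ^ 3 / 6" using bound by (simp only:)
  then have "sin x \<ge> x - x ^ 3 / 6" by linarith
  moreover have "x ^ 3 \<le> 4 * x"
  proof -
    have "x\<^sup>2 \<le> 2\<^sup>2" using x0 x2 by (rule power_mono[rotated])
    then have "x * x\<^sup>2 \<le> x * 4" using x0 by (intro mult_left_mono) auto
    then show ?thesis by (simp add: power3_eq_cube power2_eq_square mult_ac)
  qed
  ultimately have "3 * sin x \<ge> x" by simp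
  moreover have "2 * \<bar>t\<bar> \<le> x" unfolding x_def using pi_ge_two by (intro mult_right_mono) auto
  moreover have "\<bar>sin (pi * t)\<bar> \<ge> sin x" by (cases "t \<ge> 0") (simp_all add: x_def)
  ultimately show ?thesis by linarith
qed

lemma cmod_one_minus_character_axis:
  "cmod (1 - character (axis j 1) x) = 2 * \<bar>sin (pi * x $ j)\<bar>"
proof -
  have "character (axis j 1) x = exp (\<i> * of_real (2 * pi * x $ j))"
    by (simp add: character_def zvec_axis inner_axis' mult_ac)
  then show ?thesis
    using dist_exp_i_1[of "2 * pi * x $ j"] by (simp add: norm_minus_commute)
qed

text \<open>By periodicity \<open>x\<close> may be moved to its lattice translate nearest to
  \<open>y\<close>, and the mean value inequality applies there. Distance is measured by
  \<open>cmod (1 - character _ _)\<close>, a periodic quantity, because concentration of the packets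
  is expressed in it.\<close>

lemma C1_torus_modulus:
  fixes f :: "real ^ 'n::finite \<Rightarrow> complex"
  assumes f: "f \<in> C1_torus" and C: "\<And>j x. cmod (partial j f x) \<le> C"
  shows "cmod (f x - f y) \<le>
    (real CARD('n) * C) * (\<Sum>j\<in>UNIV. cmod (1 - character (axis j 1) (y - x)))"
proof -
  have per: "f (u + zvec m) = f u" for u m
    using f by (auto simp: C1_torus_def periodic_def)
  have C0: "C \<ge> 0" using C[of undefined 0] norm_ge_zero order.trans by blast
  have der: "(f has_derivative frechet_derivative f (at u)) (at u)" for u
    using f by (auto simp: C1_torus_def differentiable_on_def frechet_derivative_works)
  \<comment> \<open>The derivative in direction \<open>h\<close> is a sum of \<open>CARD('n)\<close>
    partial derivatives, each at most \<open>C\<close>, with coefficients at most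
    \<open>norm h\<close>.\<close>
  have bound: "onorm (frechet_derivative f (at u)) \<le> real CARD('n) * C" for u
  proof (rule onorm_le)
    fix h :: "real ^ 'n"
    interpret linear "frechet_derivative f (at u)"
      using der[of u] by (rule has_derivative_linear)
    have "frechet_derivative f (at u) h =
        frechet_derivative f (at u) (\<Sum>j\<in>UNIV. (h $ j) *\<^sub>R axis j 1)"
      using basis_expansion[of h] by (simp add: scalar_mult_eq_scaleR)
    also have "\<dots> = (\<Sum>j\<in>UNIV. (h $ j) *\<^sub>R partial j f u)"
      by (simp add: sum scale partial_def)
    finally have "cmod (frechet_derivative f (at u) h) = cmod (\<Sum>j\<in>UNIV. (h $ j) *\<^sub>R partial j f u)"
      by simp
    also have "\<dots> \<le> (\<Sum>j\<in>(UNIV :: 'n set). norm h * C)"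
      using C0 by (intro sum_norm_le) (auto intro!: mult_mono C component_le_norm_cart)
    finally show "cmod (frechet_derivative f (at u) h) \<le> real CARD('n) * C * norm h"
      by (simp add: mult_ac)
  qed
  \<comment> \<open>Rounding brings every coordinate of \<open>h\<close> into the interval from -1/2
    to 1/2, where \<open>half_abs_le_abs_sin\<close> applies.\<close>
  define m :: "int ^ 'n" where "m = (\<chi> j. - round ((x - y) $ j))"
  define h where "h = x + zvec m - y"
  have h_le: "\<bar>h $ j\<bar> \<le> 1 / 2" for j
    using of_int_round_abs_le[of "(x - y) $ j"]
    by (simp add: h_def m_def zvec_def abs_minus_commute algebra_simps)
  have hj: "\<bar>h $ j\<bar> \<le> cmod (1 - character (axis j 1) (y - x))" for j
  proof -
    have "character (axis j 1) (y - x) = cnj (character (axis j 1) (x - y))"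
      using character_uminus_right[of "axis j 1" "x - y"] by simp
    also have "character (axis j 1) (x - y) = character (axis j 1) h"
      using character_periodic[of "axis j 1" "x - y" m] by (simp add: h_def algebra_simps)
    finally have "1 - character (axis j 1) (y - x) = cnj (1 - character (axis j 1) h)" by simp
    then have "cmod (1 - character (axis j 1) (y - x)) = cmod (1 - character (axis j 1) h)"
      by (metis complex_mod_cnj)
    then show ?thesis
      using half_abs_le_abs_sin[OF h_le[of j]] by (simp add: cmod_one_minus_character_axis)
  qed
  have "cmod (f (x + zvec m) - f y) \<le> real CARD('n) * C * norm (x + zvec m - y)"
    by (rule differentiable_bound[of UNIV f "\<lambda>u. frechet_derivative f (at u)"])
      (auto intro: der bound)
  also have "\<dots> \<le> real CARD('n) * C * (\<Sum>j\<in>UNIV. cmod (1 - character (axis j 1) (y - x)))"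
  proof (intro mult_left_mono)
    have "norm h \<le> (\<Sum>j\<in>UNIV. \<bar>h $ j\<bar>)" by (rule norm_le_l1_cart)
    also have "\<dots> \<le> (\<Sum>j\<in>UNIV. cmod (1 - character (axis j 1) (y - x)))"
      by (intro sum_mono hj)
    finally show "norm (x + zvec m - y) \<le> (\<Sum>j\<in>UNIV. cmod (1 - character (axis j 1) (y - x)))"
      by (simp add: h_def)
  qed (use C0 in auto)
  finally show ?thesis by (simp add: per)
qed

lemma C1_torus_continuous: "f \<in> C1_torus \<Longrightarrow> continuous_on UNIV f"
  by (auto simp: C1_torus_def intro: differentiable_imp_continuous_on)

section \<open>Decay of differences and slow variation\<close>

lemma slowly_varying_powr:
  assumes bound: "\<And>k x. cmod (\<sigma> (k + m) x - \<sigma> k x) \<le> c * (1 + znorm k) powr - \<rho>" and "\<rho> > 0"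
  shows "slowly_varying \<sigma> m"
  unfolding slowly_varying_def
proof (intro allI impI)
  fix e :: real assume "e > 0"
  have "filterlim (\<lambda>k. 1 + znorm k) at_top (filtercomap znorm at_top)"
    by (rule filterlim_tendsto_add_at_top[OF tendsto_const filterlim_filtercomap])
  then have "((\<lambda>k. (1 + znorm k) powr - \<rho>) \<longlongrightarrow> 0) (filtercomap znorm at_top)"
    using \<open>\<rho> > 0\<close> by (intro tendsto_neg_powr) auto
  then have "((\<lambda>k. c * (1 + znorm k) powr - \<rho>) \<longlongrightarrow> 0) (filtercomap znorm at_top)"
    by (rule tendsto_mult_right_zero)
  then have "\<forall>\<^sub>F k in filtercomap znorm at_top. c * (1 + znorm k) powr - \<rho> < e"
    using \<open>e > 0\<close> by (rule order_tendstoD)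
  then show "\<forall>\<^sub>F k in filtercomap znorm at_top. \<forall>x. cmod (\<sigma> (k + m) x - \<sigma> k x) \<le> e"
    by (rule eventually_mono) (meson bound less_imp_le order.trans)
qed

text \<open>By orthogonality the Fourier coefficients of \<open>character m - 1\<close> select just
  the terms \<open>l = k + m\<close> and \<open>l = k\<close>, so the generalised difference reduces
  to an ordinary one.\<close>

lemma gen_difference_character:
  "gen_difference (\<lambda>y. character m y - 1) \<tau> k = \<tau> (k + m) - \<tau> k" for m :: "int ^ 'n::finite"
proof -
  have "(LINT y|torus. character (k - l) y * (character m y - 1)) =
      (if l = k + m then 1 else 0) - (if l = k then 1 else 0)" for l
  proof -
    have "(LINT y|torus. character (k - l) y * (character m y - 1)) =
        (LINT y|torus. character (k - l + m) y - character (k - l) y)"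
      by (simp only: character_add right_diff_distrib mult_1_right)
    also have "\<dots> = (if k - l + m = 0 then 1 else 0) - (if k - l = 0 then 1 else 0)"
      by (subst Bochner_Integration.integral_diff)
        (simp_all only: integrable_torus continuous_on_character integral_torus_character)
    also have "k - l + m = 0 \<longleftrightarrow> l = k + m" by (auto simp: algebra_simps)
    also have "k - l = 0 \<longleftrightarrow> l = k" by auto
    finally show ?thesis .
  qed
  then have "gen_difference (\<lambda>y. character m y - 1) \<tau> k =
      (\<Sum>\<^sub>\<infinity>l. \<tau> l * ((if l = k + m then 1 else 0) - (if l = k then 1 else 0)))"
    by (simp add: gen_difference_def)
  also have "\<dots> = (\<Sum>\<^sub>\<infinity>l\<in>{k + m, k}. \<tau> l * ((if l = k + m then 1 else 0) - (if l = k then 1 else 0)))"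
    by (rule infsum_cong_neutral) auto
  \<comment> \<open>For \<open>m = 0\<close> the two indices coincide and both sides are 0.\<close>
  also have "\<dots> = \<tau> (k + m) - \<tau> k"
    by (cases "m = 0") auto
  finally show ?thesis .
qed

section \<open>First-order estimates in the class \<open>S0\<close>\<close>

lemma coords: "distinct (coords :: 'n::finite list)" "set (coords :: 'n list) = UNIV"
proof -
  have "\<exists>js :: 'n list. distinct js \<and> set js = UNIV"
    using finite_distinct_list[of "UNIV :: 'n set"] by auto
  then have "distinct (coords :: 'n list) \<and> set (coords :: 'n list) = UNIV"
    unfolding coords_def by (rule someI_ex)
  then show "distinct (coords :: 'n list)" "set (coords :: 'n list) = UNIV" by auto
qed

lemma foldr_all_id: "(\<And>i x. i \<in> set xs \<Longrightarrow> F i x = x) \<Longrightarrow> foldr F xs y = y"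
  by (induction xs) auto

text \<open>Makes the arbitrary order of \<open>coords\<close> irrelevant for multi-indices
  supported on one coordinate: all other factors act as the identity.\<close>

lemma foldr_single:
  assumes "distinct xs" "j \<in> set xs" "\<And>i x. i \<noteq> j \<Longrightarrow> F i x = x"
  shows "foldr F xs y = F j y"
  using assms
proof (induction xs)
  case (Cons a xs)
  show ?case
  proof (cases "a = j")
    case True
    have "foldr F xs y = y"
    proof (rule foldr_all_id)
      fix i x assume "i \<in> set xs"
      then have "i \<noteq> j" using Cons.prems(1) True by auto
      then show "F i x = x" by (rule Cons.prems(3))
    qed
    then show ?thesis using True by simp
  next
    case False
    then show ?thesis using Cons by auto
  qed
qed simp

lemma multi_D_0: "multi_D (\<lambda>_. 0) f = f"
  by (simp add: multi_D_def foldr_all_id)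

lemma multi_D_single:
  "multi_D (\<lambda>i. if i = j then 1 else 0) f = (\<lambda>x. 1 / (2 * pi * \<i>) * partial j f x)"
  unfolding multi_D_def by (subst foldr_single[where j = j]) (simp_all add: coords)

lemma multi_difference_0: "multi_difference (\<lambda>_. 0) \<tau> = \<tau>"
  by (simp add: multi_difference_def foldr_all_id)

lemma multi_difference_single:
  "multi_difference (\<lambda>i. if i = j then 1 else 0) \<tau> = difference j \<tau>"
  unfolding multi_difference_def by (subst foldr_single[where j = j]) (simp_all add: coords)

lemma S0_D:
  assumes "\<sigma> \<in> S0"
  obtains C where "\<And>k x. cmod (multi_D \<beta> (\<lambda>y. multi_difference \<alpha> (\<lambda>l. \<sigma> l y) k) x)
    \<le> C * (1 + znorm k) powr - real (\<Sum>j\<in>UNIV. \<alpha> j)"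
  using assms unfolding S0_def by blast

text \<open>One difference and no derivative: the symbol estimate then decays with exponent
  1.\<close>

lemma S0_slowly_varying:
  assumes "\<sigma> \<in> S0"
  shows "slowly_varying \<sigma> (axis j 1)"
proof -
  obtain C where C: "\<And>k x. cmod (multi_D (\<lambda>_. 0)
      (\<lambda>y. multi_difference (\<lambda>i. if i = j then 1 else 0) (\<lambda>l. \<sigma> l y) k) x)
      \<le> C * (1 + znorm k) powr - real (\<Sum>i\<in>UNIV. if i = j then 1 else 0)"
    using S0_D[OF assms, where \<beta> = "\<lambda>_. 0" and \<alpha> = "\<lambda>i. if i = j then 1 else 0"] by blast
  show ?thesis
  proof (rule slowly_varying_powr)
    show "cmod (\<sigma> (k + axis j 1) x - \<sigma> k x) \<le> C * (1 + znorm k) powr - 1" for k x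
      using C[of k x] by (simp add: multi_D_0 multi_difference_single difference_def)
  qed simp
qed

text \<open>No difference and one derivative: the first-order \<open>D_coord\<close> is
  \<open>partial\<close> divided by \<open>2 * pi * \<i>\<close>. A maximum over the finitely many
  coordinates makes the bound uniform in \<open>j\<close>.\<close>

lemma S0_partial_bounded:
  assumes "\<sigma> \<in> S0"
  obtains C where "\<And>j k x. cmod (partial j (\<sigma> k) x) \<le> C"
proof -
  have "\<exists>C. \<forall>k x. cmod (partial j (\<sigma> k) x) \<le> C" for j
  proof -
    obtain C where C: "\<And>k x. cmod (multi_D (\<lambda>i. if i = j then 1 else 0)
        (\<lambda>y. multi_difference (\<lambda>_. 0) (\<lambda>l. \<sigma> l y) k) x)
        \<le> C * (1 + znorm k) powr - real (\<Sum>i\<in>(UNIV :: 'a set). 0)"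
      using S0_D[OF assms, where \<beta> = "\<lambda>i. if i = j then 1 else 0" and \<alpha> = "\<lambda>_. 0"] by blast
    have "cmod (partial j (\<sigma> k) x) \<le> 2 * pi * C" for k x
    proof -
      \<comment> \<open>A power with exponent 0 under \<open>powr\<close> equals 1 only for a
        nonzero base.\<close>
      have "1 + znorm k > 0" by (simp add: znorm_def add_pos_nonneg)
      then have "cmod (partial j (\<sigma> k) x) / (2 * pi) \<le> C"
        using C[of k x]
        by (simp add: multi_D_single multi_difference_0 norm_mult norm_divide)
      then show ?thesis by (simp add: field_simps)
    qed
    then show ?thesis by blast
  qed
  then obtain C where C: "\<And>j k x. cmod (partial j (\<sigma> k) x) \<le> C j" by metis
  have "cmod (partial j (\<sigma> k) x) \<le> Max (range C)" for j k x
    using C[of j k x] by (rule order.trans) simp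
  then show thesis by (rule that)
qed

lemma S0_C1_torus: "\<sigma> \<in> S0 \<Longrightarrow> \<sigma> k \<in> C1_torus"
  by (simp add: S0_def smooth_torus_def C1_torus_def del: times_cont_diff.simps)

lemma Limsup_C1_symbol_le_operator_norm:
  fixes \<sigma> :: "int ^ 'n::finite \<Rightarrow> real ^ 'n \<Rightarrow> complex"
  assumes K: "compact_operator K" and C1: "\<And>k. \<sigma> k \<in> C1_torus"
    and C: "\<And>j k x. cmod (partial j (\<sigma> k) x) \<le> C"
    and slow: "\<And>j. slowly_varying \<sigma> (axis j 1)"
  shows "Limsup (filtercomap znorm at_top) (\<lambda>k. SUP x. ereal (cmod (\<sigma> k x)))
    \<le> ell2_operator_norm (\<lambda>f k. Op \<sigma> f k - K f k)"
  by (rule Limsup_symbol_le_operator_norm[OF K C1_torus_continuous[OF C1]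
        C1_torus_modulus[OF C1 C] slow])

theorem corollary5p4:
  fixes \<sigma> :: "int ^ 'n::finite \<Rightarrow> real ^ 'n \<Rightarrow> complex"
    and K :: "(int ^ 'n \<Rightarrow> complex) \<Rightarrow> (int ^ 'n \<Rightarrow> complex)"
  assumes "compact_operator K"
  shows
    "((\<forall>k. \<sigma> k \<in> C1_torus) \<and>
      (\<exists>C>0. \<exists>\<rho>>0.
         (\<forall>k x. cmod (\<sigma> k x) \<le> C) \<and>
         (\<forall>k x. norm (grad (\<sigma> k) x) \<le> C) \<and>
         (\<forall>q\<in>smooth_torus. q 0 = 0 \<longrightarrow>
            (\<exists>Cq>0. \<forall>k x. cmod (gen_difference q (\<lambda>l. \<sigma> l x) k) \<le> Cq * (1 + znorm k) powr - \<rho>)))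
      \<longrightarrow> ell2_operator_norm (\<lambda>f k. Op \<sigma> f k - K f k)
            \<ge> Limsup (filtercomap znorm at_top) (\<lambda>k. SUP x. ereal (cmod (\<sigma> k x))))
     \<and> (\<sigma> \<in> S0
      \<longrightarrow> ell2_operator_norm (\<lambda>f k. Op \<sigma> f k - K f k)
            \<ge> Limsup (filtercomap znorm at_top) (\<lambda>k. SUP x. ereal (cmod (\<sigma> k x))))"
proof (intro conjI impI; (elim conjE exE)?)
  fix C \<rho> :: real
  assume C1: "\<forall>k. \<sigma> k \<in> C1_torus" and "\<rho> > 0"
    and grad: "\<forall>k x. norm (grad (\<sigma> k) x) \<le> C"
    and diff: "\<forall>q\<in>smooth_torus. q 0 = 0 \<longrightarrow>
      (\<exists>Cq>0. \<forall>k x. cmod (gen_difference q (\<lambda>l. \<sigma> l x) k) \<le> Cq * (1 + znorm k) powr - \<rho>)"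
  show "ell2_operator_norm (\<lambda>f k. Op \<sigma> f k - K f k)
      \<ge> Limsup (filtercomap znorm at_top) (\<lambda>k. SUP x. ereal (cmod (\<sigma> k x)))"
  proof (rule Limsup_C1_symbol_le_operator_norm[OF assms])
    show "\<sigma> k \<in> C1_torus" for k using C1 by blast
    show "cmod (partial j (\<sigma> k) x) \<le> C" for j k x
      using Finite_Cartesian_Product.norm_nth_le[of "grad (\<sigma> k) x" j] grad[rule_format, of k x]
      by (simp add: grad_def)
    show "slowly_varying \<sigma> (axis j 1)" for j
    proof -
      \<comment> \<open>This is the test function \<open>q\<close> for direction \<open>j\<close>:
        it is smooth, vanishes at 0, and its generalised difference is the unit difference.\<close>
      have "(\<lambda>y. character (axis j 1) y - 1) \<in> smooth_torus"
        using smooth_torus_affine_character[of 1 "axis j 1" "- 1"] by simp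
      moreover have "character (axis j 1) (0 :: real ^ 'n) - 1 = 0"
        by (simp add: character_eq_cis)
      ultimately obtain Cq where
        "\<forall>k x. cmod (gen_difference (\<lambda>y. character (axis j 1) y - 1) (\<lambda>l. \<sigma> l x) k)
          \<le> Cq * (1 + znorm k) powr - \<rho>"
        using bspec[OF diff] by meson
      then show ?thesis
        unfolding gen_difference_character
        by (intro slowly_varying_powr[where c = Cq, OF _ \<open>\<rho> > 0\<close>]) simp
    qed
  qed
next
  assume S0: "\<sigma> \<in> S0"
  obtain C where "\<And>j k x. cmod (partial j (\<sigma> k) x) \<le> C"
    using S0_partial_bounded[OF S0] by blast
  then show "ell2_operator_norm (\<lambda>f k. Op \<sigma> f k - K f k)
      \<ge> Limsup (filtercomap znorm at_top) (\<lambda>k. SUP x. ereal (cmod (\<sigma> k x)))"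
    by (rule Limsup_C1_symbol_le_operator_norm[OF assms S0_C1_torus[OF S0] _ S0_slowly_varying[OF S0]])
qed

end
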